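(* Let $R$ be a Dedekind domain with fraction field $K$, let $\mathbf{X}\in R^{n\times n}$ be a symmetric matrix, and suppose that $\mathbf{Y}\in R^{n\times n}$ and a nonzero matrix $\mathbf{Q}\in K^{n\times n}$ satisfy $\mathbf{X}\mathbf{Q}=\mathbf{Q}\mathbf{Y}$ and $\mathbf{Q}^{\mathsf T}\mathbf{Q}\in R^{n\times n}$. Let $\mathcal{L}\subseteq R$ be the level of $\mathbf{Q}$ and let $\Delta_{\mathbf{X}}\in R$ be the discriminant of $\mathbf{X}$. If $\mathcal{P}\mid\mathcal{L}$ for some nonzero prime ideal $\mathcal{P}\subseteq R$, then $\mathcal{P}^2\mid \Delta_{\mathbf{X}}R$.
   Context: Rings are commutative and unital. A Dedekind domain is a Noetherian integral domain in which every nonzero proper ideal factors as a product of powers of nonzero prime ideals (uniquely up to reordering). The level of $\mathbf{Q}$ is the ideal $\mathcal{L}=\{r\in R: r\mathbf{Q}\in R^{n\times n}\}$. With $\phi_{\mathbf{X}}(x)=\det(x\mathbf{I}-\mathbf{X})$ and $\phi_{\mathbf{X}}'$ its formal derivative, the discriminant is $\Delta_{\mathbf{X}}=\det(\phi_{\mathbf{X}}'(\mathbf{X}))\in R$. For ideals, $\mathcal{B}\mid\mathcal{A}$ means that there is an ideal $\mathcal{C}\subseteq R$ with $\mathcal{B}\mathcal{C}=\mathcal{A}$. *)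

theory Defs
  imports
    "HOL-Algebra.Algebraic_Closure_Type"
    "HOL-Algebra.Ideal_Product"
    "HOL-Algebra.Ring_Divisibility"
    "HOL-Computational_Algebra.Polynomial_Factorial"
    "Jordan_Normal_Form.Char_Poly"
begin

(* Existence and uniqueness up to reordering of the factorization are stated through the
   finitely supported function e that sends a nonzero prime ideal to its exponent. Products and
   powers of ideals are those of the commutative monoid ideals_set R. Fields are allowed. *)
locale dedekind_domain = noetherian_domain +
  assumes ideal_factorization:
    "\<lbrakk> ideal A R; A \<noteq> {\<zero>}; A \<noteq> carrier R \<rbrakk> \<Longrightarrow>
     \<exists>!e :: 'a set \<Rightarrow> nat.
       finite {P. e P \<noteq> 0} \<and>
       (\<forall>P. e P \<noteq> 0 \<longrightarrow> primeideal P R \<and> P \<noteq> {\<zero>}) \<and>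
       A = (\<Otimes>\<^bsub>ideals_set R\<^esub>P \<in> {P. e P \<noteq> 0}. P [^]\<^bsub>ideals_set R\<^esub> e P)"

definition integral_mats :: "nat \<Rightarrow> 'a::idom fract mat set" where
  "integral_mats n = map_mat to_fract ` carrier_mat n n"

definition level :: "nat \<Rightarrow> 'a::idom fract mat \<Rightarrow> 'a set" where
  "level n Q = {r. to_fract r \<cdot>\<^sub>m Q \<in> integral_mats n}"

(* The matrix p(A) for a square matrix A, as the entrywise sum of the coeff p k * A^k. *)
definition poly_mat :: "'a::comm_ring_1 poly \<Rightarrow> 'a mat \<Rightarrow> 'a mat" where
  "poly_mat p A = mat (dim_row A) (dim_row A)
     (\<lambda>(i, j). \<Sum>k\<le>degree p. coeff p k * (A ^\<^sub>m k) $$ (i, j))"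

definition discriminant :: "'a::idom mat \<Rightarrow> 'a" where
  "discriminant A = det (poly_mat (pderiv (char_poly A)) A)"

lemma integral_mats_iff:
  "A \<in> integral_mats n \<longleftrightarrow>
     A \<in> carrier_mat n n \<and> (\<forall>i<n. \<forall>j<n. A $$ (i, j) \<in> range to_fract)"
proof
  assume "A \<in> integral_mats n"
  then show "A \<in> carrier_mat n n \<and> (\<forall>i<n. \<forall>j<n. A $$ (i, j) \<in> range to_fract)"
    by (auto simp: integral_mats_def)
next
  assume A: "A \<in> carrier_mat n n \<and> (\<forall>i<n. \<forall>j<n. A $$ (i, j) \<in> range to_fract)"
  then have "A = map_mat to_fract (map_mat (inv_into UNIV to_fract) A)"
    by (intro eq_matI) (auto simp: f_inv_into_f)
  moreover have "map_mat (inv_into UNIV to_fract) A \<in> carrier_mat n n" using A by auto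
  ultimately show "A \<in> integral_mats n" unfolding integral_mats_def by blast
qed

lemma ideal_level:
  fixes Q :: "'a::idom fract mat"
  assumes "Q \<in> carrier_mat n n"
  shows "ideal (level n Q) (ring_of_type_algebra :: 'a ring)"
proof -
  let ?R = "ring_of_type_algebra :: 'a ring"
  interpret cring ?R by (rule cring_from_type_algebra)
  have mem: "r \<in> level n Q \<longleftrightarrow> (\<forall>i<n. \<forall>j<n. \<exists>a. to_fract r * Q $$ (i, j) = to_fract a)"
    for r using assms by (auto simp: level_def integral_mats_iff image_iff)
  have add: "r + s \<in> level n Q" if "r \<in> level n Q" "s \<in> level n Q" for r s
    using that unfolding mem by (metis distrib_right to_fract_add)
  have mult: "s * r \<in> level n Q" if "r \<in> level n Q" for r s
    using that unfolding mem by (metis mult.assoc to_fract_mult)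
  have zero: "0 \<in> level n Q" unfolding mem by (metis mult_zero_left to_fract_0)
  have sub: "subgroup (level n Q) (add_monoid ?R)"
  proof (rule add.subgroupI)
    fix r assume r: "r \<in> level n Q"
    have "\<ominus>\<^bsub>?R\<^esub> r = - r"
      by (rule minus_equality) (simp_all add: ring_of_type_algebra_def)
    then show "\<ominus>\<^bsub>?R\<^esub> r \<in> level n Q"
      using mult[OF r, of "- 1"] by simp
  qed (use add zero in \<open>auto simp: ring_of_type_algebra_def\<close>)
  show ?thesis
  proof (rule idealI[OF ring_axioms sub])
    show "s \<otimes>\<^bsub>?R\<^esub> r \<in> level n Q" "r \<otimes>\<^bsub>?R\<^esub> s \<in> level n Q" if "r \<in> level n Q" for r s
      using mult[OF that, of s] by (simp_all add: ring_of_type_algebra_def mult.commute)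
  qed
qed

end

theory Submission
  imports Defs
begin

text \<open>Scaling \<open>Q\<close> by a suitable element of \<open>P\<close> gives an integral matrix \<open>M\<close> with an entry outside \<open>P\<close> such
  that \<open>A M = M B\<close> and \<open>M\<^sup>T M\<close> has entries in \<open>P\<^sup>2\<close>. Modulo \<open>P\<close>, the column module \<open>V\<close> of \<open>M\<close> is a nonzero
  \<open>A\<close>-stable totally isotropic space. An isotropic eigenvector of a symmetric matrix belongs to a multiple
  root of the characteristic polynomial \<open>\<phi>\<close>, because the adjugate of \<open>\<lambda> - A\<close> is then a multiple of \<open>v v\<^sup>T\<close>
  and its trace is \<open>\<phi>'(\<lambda>)\<close>. Hence some \<open>v\<close> in \<open>V\<close>, nonzero modulo \<open>P\<close>, satisfies \<open>\<phi>'(A) v = 0\<close> modulo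
  \<open>P\<close>. In a basis containing \<open>v\<close>, the row and the column of the symmetric form \<open>\<phi>'(A)\<close> at \<open>v\<close> lie in \<open>P\<close>
  and their common entry \<open>v\<^sup>T \<phi>'(A) v\<close> lies in \<open>P\<^sup>2\<close>, so \<open>det \<phi>'(A)\<close> lies in \<open>P\<^sup>2\<close>.\<close>

section \<open>Ideals of Dedekind domains\<close>

lemma (in ring) ideal_prod_subset:
  assumes "ideal K R" and "\<And>i j. \<lbrakk> i \<in> I; j \<in> J \<rbrakk> \<Longrightarrow> i \<otimes> j \<in> K"
  shows "I \<cdot> J \<subseteq> K"
proof
  fix s assume "s \<in> I \<cdot> J"
  then show "s \<in> K"
    by (induction rule: ideal_prod.induct)
      (auto intro: assms(2) additive_subgroup.a_closed[OF ideal.axioms(1)[OF assms(1)]])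
qed

lemma (in domain) ideal_prod_nonzero:
  assumes "ideal I R" "ideal J R" "I \<noteq> {\<zero>}" "J \<noteq> {\<zero>}"
  shows "I \<cdot> J \<noteq> {\<zero>}"
proof -
  have nonzero: "\<exists>a\<in>K. a \<noteq> \<zero>" if "ideal K R" "K \<noteq> {\<zero>}" for K
    using that additive_subgroup.zero_closed[OF ideal.axioms(1)[OF that(1)]] by blast
  from nonzero[OF assms(1,3)] nonzero[OF assms(2,4)]
  obtain a b where ab: "a \<in> I" "a \<noteq> \<zero>" "b \<in> J" "b \<noteq> \<zero>" by blast
  then have "a \<otimes> b \<noteq> \<zero>"
    using assms(1,2) by (simp add: integral_iff ideal.Icarr)
  then show ?thesis using ideal_prod.prod[OF ab(1,3), of R] by blast
qed

lemma (in ring) ideals_set_simps: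
  "carrier (ideals_set R) = {I. ideal I R}"
  "I \<otimes>\<^bsub>ideals_set R\<^esub> J = I \<cdot> J"
  "\<one>\<^bsub>ideals_set R\<^esub> = carrier R"
  by (simp_all add: ideals_set_def)

lemma (in cring) ideal_ideals_set_pow:
  assumes "ideal I R"
  shows "ideal (I [^]\<^bsub>ideals_set R\<^esub> (k::nat)) R"
  using monoid.nat_pow_closed[OF comm_monoid.axioms(1)[OF ideals_set_is_comm_monoid], of I k] assms
  by (simp add: ideals_set_simps)

context dedekind_domain
begin

text \<open>The product runs over the support exactly as in \<open>ideal_factorization\<close>, so
  unfolding it together with \<open>exponents\<close> turns that axiom into separate existence and
  uniqueness statements.\<close>

definition ideal_of_exponents :: "('a set \<Rightarrow> nat) \<Rightarrow> 'a set" where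
  "ideal_of_exponents e =
     (\<Otimes>\<^bsub>ideals_set R\<^esub>P \<in> {P. e P \<noteq> 0}. P [^]\<^bsub>ideals_set R\<^esub> e P)"

definition exponents :: "('a set \<Rightarrow> nat) \<Rightarrow> bool" where
  "exponents e \<longleftrightarrow> finite {P. e P \<noteq> 0} \<and> (\<forall>P. e P \<noteq> 0 \<longrightarrow> primeideal P R \<and> P \<noteq> {\<zero>})"

interpretation ISet: comm_monoid "ideals_set R"
  by (rule ideals_set_is_comm_monoid)

lemma exponents_primeideal:
  assumes "exponents e" "e P \<noteq> 0"
  shows "primeideal P R" "P \<noteq> {\<zero>}" "ideal P R"
  using assms primeideal.axioms(1) by (auto simp: exponents_def)

text \<open>Exponent 0 contributes the unit ideal. The enlargement lets exponent functions with
  different supports be compared over one index set.\<close>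

lemma ideal_of_exponents_superset:
  assumes "exponents e" "finite S" "{P. e P \<noteq> 0} \<subseteq> S" "\<And>P. P \<in> S \<Longrightarrow> ideal P R"
  shows "ideal_of_exponents e = (\<Otimes>\<^bsub>ideals_set R\<^esub>P \<in> S. P [^]\<^bsub>ideals_set R\<^esub> e P)"
  unfolding ideal_of_exponents_def
  by (rule ISet.finprod_mono_neutral_cong_left)
    (use assms in \<open>auto intro!: ideal_ideals_set_pow simp: ideals_set_simps(1)\<close>)

lemma ideal_ideal_of_exponents:
  assumes "exponents e"
  shows "ideal (ideal_of_exponents e) R"
proof -
  have "ideal_of_exponents e \<in> carrier (ideals_set R)"
    unfolding ideal_of_exponents_def using exponents_primeideal[OF assms]
    by (intro ISet.finprod_closed) (auto intro!: ideal_ideals_set_pow simp: ideals_set_simps(1))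
  then show ?thesis by (simp add: ideals_set_simps)
qed

lemma ideal_of_exponents_add:
  assumes e: "exponents e" and e': "exponents e'"
  shows "exponents (\<lambda>P. e P + e' P)"
    and "ideal_of_exponents (\<lambda>P. e P + e' P) = ideal_of_exponents e \<cdot> ideal_of_exponents e'"
proof -
  have *: "{P. e P + e' P \<noteq> 0} = {P. e P \<noteq> 0} \<union> {P. e' P \<noteq> 0}" by auto
  show sum: "exponents (\<lambda>P. e P + e' P)"
    using e e' unfolding exponents_def * by auto
  let ?S = "{P. e P + e' P \<noteq> 0}"
  have fin: "finite ?S" using e e' unfolding exponents_def * by auto
  have id: "ideal P R" if "P \<in> ?S" for P
    using exponents_primeideal(3)[OF sum, of P] that by auto
  have "ideal_of_exponents (\<lambda>P. e P + e' P) =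
      (\<Otimes>\<^bsub>ideals_set R\<^esub>P \<in> ?S. P [^]\<^bsub>ideals_set R\<^esub> e P \<otimes>\<^bsub>ideals_set R\<^esub> P [^]\<^bsub>ideals_set R\<^esub> e' P)"
    unfolding ideal_of_exponents_def using id
    by (intro ISet.finprod_cong')
      (auto intro!: ideal_ideals_set_pow ideal_prod_is_ideal simp: ISet.nat_pow_mult ideals_set_simps(1))
  also have "\<dots> = (\<Otimes>\<^bsub>ideals_set R\<^esub>P \<in> ?S. P [^]\<^bsub>ideals_set R\<^esub> e P) \<otimes>\<^bsub>ideals_set R\<^esub>
      (\<Otimes>\<^bsub>ideals_set R\<^esub>P \<in> ?S. P [^]\<^bsub>ideals_set R\<^esub> e' P)"
    using id by (intro ISet.finprod_multf) (auto intro!: ideal_ideals_set_pow simp: ideals_set_simps(1))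
  also have "\<dots> = ideal_of_exponents e \<cdot> ideal_of_exponents e'"
    using ideal_of_exponents_superset[OF e fin _ id] ideal_of_exponents_superset[OF e' fin _ id]
    by (simp add: ideals_set_simps(2) Collect_mono)
  finally show "ideal_of_exponents (\<lambda>P. e P + e' P) = ideal_of_exponents e \<cdot> ideal_of_exponents e'" .
qed

lemma exponents_exist:
  assumes "ideal A R" "A \<noteq> {\<zero>}"
  shows "\<exists>e. exponents e \<and> A = ideal_of_exponents e"
proof (cases "A = carrier R")
  case True
  \<comment> \<open>The axiom speaks of proper ideals; the unit ideal is the empty product.\<close>
  then have "exponents (\<lambda>_. 0) \<and> A = ideal_of_exponents (\<lambda>_. 0)"
    by (simp add: exponents_def ideal_of_exponents_def ideals_set_simps)
  then show ?thesis by blast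
next
  case False
  show ?thesis
    using ideal_factorization[OF assms False]
    unfolding exponents_def ideal_of_exponents_def by blast
qed

lemma exponents_unique:
  assumes "exponents e" "exponents e'" "ideal_of_exponents e = ideal_of_exponents e'"
    "ideal_of_exponents e \<noteq> {\<zero>}" "ideal_of_exponents e \<noteq> carrier R"
  shows "e = e'"
  using ideal_factorization[OF ideal_ideal_of_exponents[OF assms(1)] assms(4,5)] assms(1-3)
  unfolding exponents_def ideal_of_exponents_def by blast

text \<open>Multiplication adds exponents, so uniqueness of the factorization of the common product
  allows the exponents of \<open>A\<close> to be subtracted.\<close>

lemma ideal_prod_cancel:
  assumes A: "ideal A R" "A \<noteq> {\<zero>}" and B: "ideal B R" "B \<noteq> {\<zero>}"
    and C: "ideal C R" "C \<noteq> {\<zero>}" and eq: "A \<cdot> B = A \<cdot> C"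
  shows "B = C"
proof (cases "A \<cdot> B = carrier R")
  case True
  \<comment> \<open>Uniqueness is available for proper ideals only. Here \<open>B\<close> and
    \<open>C\<close> contain a product equal to the whole ring.\<close>
  then show ?thesis
    using eq ideal_prod_inter[OF A(1) B(1)] ideal_prod_inter[OF A(1) C(1)]
      ideal.Icarr[OF B(1)] ideal.Icarr[OF C(1)] by blast
next
  case False
  obtain a b c where *: "exponents a" "exponents b" "exponents c"
      and ABC: "A = ideal_of_exponents a" "B = ideal_of_exponents b" "C = ideal_of_exponents c"
    using exponents_exist[OF A] exponents_exist[OF B] exponents_exist[OF C] by blast
  note ab = ideal_of_exponents_add[OF *(1,2)] and ac = ideal_of_exponents_add[OF *(1,3)]
  have "(\<lambda>P. a P + b P) = (\<lambda>P. a P + c P)"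
    using exponents_unique[OF ab(1) ac(1)] ab(2) ac(2) eq False
      ideal_prod_nonzero[OF A(1) B(1) A(2) B(2)] unfolding ABC by simp
  then have "b = c" by (simp add: fun_eq_iff)
  then show ?thesis by (simp add: ABC)
qed

text \<open>A prime ideal that contains a product contains one of the factors. This is applied to
  the factorization of \<open>A\<close>, across the distinct primes and within each power, and one
  copy of the prime found is split off. That it equals \<open>P\<close> will follow from
  maximality.\<close>

lemma prime_factor_below_primeideal:
  assumes A: "ideal A R" "A \<noteq> {\<zero>}" and P: "primeideal P R" "A \<subseteq> P"
  shows "\<exists>P' C. primeideal P' R \<and> P' \<noteq> {\<zero>} \<and> P' \<subseteq> P \<and> ideal C R \<and> A = P' \<cdot> C"
proof -
  obtain e where e: "exponents e" and Ae: "A = ideal_of_exponents e"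
    using exponents_exist[OF A] by blast
  have P_proper: "\<not> carrier R \<subseteq> P"
    using primeideal.I_notcarr[OF P(1)] ideal.Icarr[OF primeideal.axioms(1)[OF P(1)]] by blast
  have pow: "P' \<subseteq> P" if "ideal P' R" "P' [^]\<^bsub>ideals_set R\<^esub> (k::nat) \<subseteq> P" for P' k
    using that(2)
  proof (induction k)
    case 0
    then show ?case using P_proper by (simp add: ideals_set_simps)
  next
    case (Suc k)
    then show ?case
      using primeideal_divides_ideal_prod[OF P(1) ideal_ideals_set_pow[OF that(1)] that(1)]
      by (auto simp: ideals_set_simps)
  qed
  have "\<exists>P'\<in>S. P' \<subseteq> P"
    if "finite S" "\<And>P'. P' \<in> S \<Longrightarrow> ideal P' R"
      "(\<Otimes>\<^bsub>ideals_set R\<^esub>P' \<in> S. P' [^]\<^bsub>ideals_set R\<^esub> e P') \<subseteq> P" for S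
    using that
  proof (induction S rule: finite_induct)
    case empty
    then show ?case using P_proper by (simp add: ideals_set_simps)
  next
    case (insert Q S)
    have Q: "Q [^]\<^bsub>ideals_set R\<^esub> e Q \<in> carrier (ideals_set R)"
      and S: "(\<lambda>P'. P' [^]\<^bsub>ideals_set R\<^esub> e P') \<in> S \<rightarrow> carrier (ideals_set R)"
      using insert.prems by (auto intro!: ideal_ideals_set_pow simp: ideals_set_simps(1))
    have "(Q [^]\<^bsub>ideals_set R\<^esub> e Q) \<cdot> (\<Otimes>\<^bsub>ideals_set R\<^esub>P' \<in> S. P' [^]\<^bsub>ideals_set R\<^esub> e P') \<subseteq> P"
      using insert.prems(2) ISet.finprod_insert[OF insert.hyps(1,2) S Q]
      by (simp add: ideals_set_simps(2))
    then have "Q [^]\<^bsub>ideals_set R\<^esub> e Q \<subseteq> P \<or>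
        (\<Otimes>\<^bsub>ideals_set R\<^esub>P' \<in> S. P' [^]\<^bsub>ideals_set R\<^esub> e P') \<subseteq> P"
      using primeideal_divides_ideal_prod[OF P(1)] Q ISet.finprod_closed[OF S]
      by (simp add: ideals_set_simps(1))
    then show ?case using pow[of Q] insert by blast
  qed
  from this[of "{P. e P \<noteq> 0}"] obtain P' where P': "e P' \<noteq> 0" "P' \<subseteq> P"
    using P(2) e exponents_primeideal(3)[OF e]
    unfolding Ae ideal_of_exponents_def exponents_def by auto
  \<comment> \<open>\<open>u\<close> is one copy of \<open>P'\<close> and \<open>d\<close> is the
    rest; the subtraction is exact because \<open>e P'\<close> is nonzero.\<close>
  define d where "d = (\<lambda>Q. if Q = P' then e Q - 1 else e Q)"
  define u where "u = (\<lambda>Q. if Q = P' then 1 else 0 :: nat)"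
  have e_eq: "e = (\<lambda>Q. u Q + d Q)" using P'(1) by (auto simp: u_def d_def)
  have u: "exponents u"
    using exponents_primeideal[OF e P'(1)] by (auto simp: exponents_def u_def)
  have "{Q. d Q \<noteq> 0} \<subseteq> {Q. e Q \<noteq> 0}" by (auto simp: d_def split: if_splits)
  then have d: "exponents d"
    using e finite_subset unfolding exponents_def by blast
  have "P' \<in> carrier (ideals_set R)"
    using exponents_primeideal(3)[OF e P'(1)] by (simp add: ideals_set_simps)
  then have "(\<Otimes>\<^bsub>ideals_set R\<^esub>Q \<in> {P'}. Q [^]\<^bsub>ideals_set R\<^esub> u Q) = P'"
    using ISet.finprod_insert[of "{}" P' "\<lambda>Q. Q [^]\<^bsub>ideals_set R\<^esub> u Q"] by (simp add: u_def)
  then have "ideal_of_exponents u = P'"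
    using ideal_of_exponents_superset[OF u, of "{P'}"] exponents_primeideal(3)[OF e P'(1)]
    by (auto simp: u_def)
  then have "A = P' \<cdot> ideal_of_exponents d"
    using ideal_of_exponents_add(2)[OF u d] Ae e_eq by simp
  then show ?thesis
    using exponents_primeideal[OF e P'(1)] P'(2) ideal_ideal_of_exponents[OF d] by blast
qed

end

section \<open>Ideals of the ring on a type, described by elements\<close>

abbreviation (input) type_ring :: "'a::comm_ring_1 ring" where
  "type_ring \<equiv> ring_of_type_algebra"

lemma type_ring_simps [simp]:
  "carrier type_ring = UNIV" "x \<otimes>\<^bsub>type_ring\<^esub> y = x * y" "\<one>\<^bsub>type_ring\<^esub> = 1"
  "\<zero>\<^bsub>type_ring\<^esub> = 0" "x \<oplus>\<^bsub>type_ring\<^esub> y = x + y"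
  by (simp_all add: ring_of_type_algebra_def)

lemma ideal_type_ring_iff:
  fixes I :: "'a::comm_ring_1 set"
  shows "ideal I type_ring \<longleftrightarrow> 0 \<in> I \<and> (\<forall>a\<in>I. \<forall>b\<in>I. a + b \<in> I) \<and> (\<forall>a\<in>I. \<forall>r. r * a \<in> I)"
    (is "?L \<longleftrightarrow> ?R")
proof
  interpret cring "type_ring :: 'a ring" by (rule cring_from_type_algebra)
  show ?R if ?L
  proof -
    interpret I: ideal I type_ring by (rule that)
    show ?R using I.zero_closed I.a_closed I.I_l_closed by auto
  qed
  show ?L if R: ?R
  proof (rule idealI[OF ring_axioms])
    show "subgroup I (add_monoid type_ring)"
    proof (rule add.subgroupI)
      fix a assume a: "a \<in> I"
      have "\<ominus>\<^bsub>type_ring\<^esub> a = - 1 * a" by (rule minus_equality) simp_all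
      moreover have "- 1 * a \<in> I" using R a by blast
      ultimately show "\<ominus>\<^bsub>type_ring\<^esub> a \<in> I" by simp
    qed (use R in auto)
  qed (use R in \<open>auto simp: mult.commute\<close>)
qed

lemma primeideal_type_ring_iff:
  fixes P :: "'a::comm_ring_1 set"
  shows "primeideal P type_ring \<longleftrightarrow>
    ideal P type_ring \<and> 1 \<notin> P \<and> (\<forall>a b. a * b \<in> P \<longrightarrow> a \<in> P \<or> b \<in> P)" (is "?L \<longleftrightarrow> ?R")
proof
  interpret cring "type_ring :: 'a ring" by (rule cring_from_type_algebra)
  show ?R if ?L
  proof -
    interpret P: primeideal P type_ring by (rule that)
    show ?R
      using P.is_ideal P.I_prime P.I_notcarr P.one_imp_carrier by auto
  qed
  show ?L if ?R
    using that by (intro primeidealI cring_from_type_algebra) auto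
qed

context
  fixes I :: "'a::comm_ring_1 set"
  assumes I: "ideal I type_ring"
begin

lemma ideal_zero: "0 \<in> I"
  and ideal_add: "\<lbrakk> a \<in> I; b \<in> I \<rbrakk> \<Longrightarrow> a + b \<in> I"
  and ideal_mult_left: "a \<in> I \<Longrightarrow> r * a \<in> I"
  and ideal_mult_right: "a \<in> I \<Longrightarrow> a * r \<in> I"
  using I unfolding ideal_type_ring_iff by (blast, blast, blast, metis mult.commute)

lemma ideal_uminus: "a \<in> I \<Longrightarrow> - a \<in> I"
  using ideal_mult_left[of a "- 1"] by (simp only: mult_minus1)

lemma ideal_diff: "\<lbrakk> a \<in> I; b \<in> I \<rbrakk> \<Longrightarrow> a - b \<in> I"
  using ideal_add[of a "- b"] ideal_uminus[of b] by (simp only: diff_conv_add_uminus)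

lemma ideal_add_cancel: "a \<in> I \<Longrightarrow> a + b \<in> I \<longleftrightarrow> b \<in> I"
  using ideal_add[of a b] ideal_diff[of "a + b" a] by (auto simp only: add_diff_cancel_left')

lemma ideal_sum: "(\<And>x. x \<in> S \<Longrightarrow> f x \<in> I) \<Longrightarrow> sum f S \<in> I"
  by (induction S rule: infinite_finite_induct) (auto intro: ideal_zero ideal_add)

end

lemmas ideal_intros = ideal_zero ideal_add ideal_mult_left ideal_mult_right ideal_uminus ideal_diff
  ideal_sum

lemma primeideal_ideal: "primeideal P type_ring \<Longrightarrow> ideal P type_ring"
  by (rule primeideal.axioms(1))

lemma primeideal_mult_iff:
  assumes "primeideal P type_ring"
  shows "a * b \<in> P \<longleftrightarrow> a \<in> P \<or> b \<in> P"
  using assms ideal_mult_left[OF primeideal_ideal[OF assms]]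
    ideal_mult_right[OF primeideal_ideal[OF assms]]
  unfolding primeideal_type_ring_iff by blast

lemma primeideal_power_notin:
  assumes P: "primeideal P type_ring" and "a \<notin> P"
  shows "a ^ k \<notin> P"
proof (induction k)
  case 0
  then show ?case using P by (simp add: primeideal_type_ring_iff)
next
  case (Suc k)
  then show ?case using assms(2) by (simp add: primeideal_mult_iff[OF P])
qed

text \<open>Clearing the denominator of the fractional ideal generated by 1 and \<open>a / b\<close>
  leads to \<open>ideal2 a b\<close>; principal ideals occur as \<open>ideal2 a 0\<close>.\<close>

definition ideal2 :: "'a::comm_ring_1 \<Rightarrow> 'a \<Rightarrow> 'a set" where
  "ideal2 a b = {r * a + s * b | r s. True}"

lemma ideal2_ideal: "ideal (ideal2 a b) type_ring"
proof -
  have "0 = 0 * a + 0 * b" by simp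
  moreover have "(r * a + s * b) + (r' * a + s' * b) = (r + r') * a + (s + s') * b"
    "t * (r * a + s * b) = (t * r) * a + (t * s) * b" for r s r' s' t
    by (simp_all add: algebra_simps)
  ultimately show ?thesis unfolding ideal_type_ring_iff ideal2_def by blast
qed

lemma ideal2_gens: "a \<in> ideal2 a b" "b \<in> ideal2 a b"
proof -
  have "a = 1 * a + 0 * b" "b = 0 * a + 1 * b" by simp_all
  then show "a \<in> ideal2 a b" "b \<in> ideal2 a b" unfolding ideal2_def by blast+
qed

lemma ideal2_subset: "ideal I type_ring \<Longrightarrow> a \<in> I \<Longrightarrow> b \<in> I \<Longrightarrow> ideal2 a b \<subseteq> I"
  by (auto simp: ideal2_def intro!: ideal_add ideal_mult_left)

lemma ideal2_zero_iff: "c \<in> ideal2 a 0 \<longleftrightarrow> a dvd c"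
  by (simp add: ideal2_def dvd_def mult.commute[of _ a])

lemma ideal_prod_mem: "a \<in> I \<Longrightarrow> b \<in> J \<Longrightarrow> a * b \<in> I \<cdot>\<^bsub>type_ring\<^esub> J"
  using ideal_prod.prod[of a I b J type_ring] by simp

lemma ideal_prod_type_ring_ideal:
  fixes I J :: "'a::comm_ring_1 set"
  shows "ideal I type_ring \<Longrightarrow> ideal J type_ring \<Longrightarrow> ideal (I \<cdot>\<^bsub>type_ring\<^esub> J) type_ring"
  by (rule ring.ideal_prod_is_ideal[OF ring_from_type_algebra])

lemma ideal_prod_type_ring_subset:
  fixes K :: "'a::comm_ring_1 set"
  assumes "ideal K type_ring" "\<And>i j. i \<in> I \<Longrightarrow> j \<in> J \<Longrightarrow> i * j \<in> K"
  shows "I \<cdot>\<^bsub>type_ring\<^esub> J \<subseteq> K"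
  using ring.ideal_prod_subset[OF ring_from_type_algebra assms(1), of I J] assms(2) by simp

lemma ideal2_prod_subset:
  fixes K :: "'a::comm_ring_1 set"
  assumes K: "ideal K type_ring" and gens: "\<And>j. j \<in> J \<Longrightarrow> a * j \<in> K" "\<And>j. j \<in> J \<Longrightarrow> b * j \<in> K"
  shows "ideal2 a b \<cdot>\<^bsub>type_ring\<^esub> J \<subseteq> K"
proof (rule ideal_prod_type_ring_subset[OF K])
  fix i j assume "i \<in> ideal2 a b" "j \<in> J"
  then obtain r s where "i = r * a + s * b" by (auto simp: ideal2_def)
  then have "i * j = r * (a * j) + s * (b * j)" by (simp add: algebra_simps)
  then show "i * j \<in> K" using gens[OF \<open>j \<in> J\<close>] by (simp add: ideal_intros[OF K])
qed

section \<open>Divisibility by a prime ideal and by its square\<close>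

context
  assumes dedekind: "dedekind_domain (type_ring :: 'a::idom ring)"
begin

lemma type_ring_ideal_prod_cancel:
  fixes A B C :: "'a set"
  assumes "ideal A type_ring" "a \<in> A" "a \<noteq> 0" "ideal B type_ring" "b \<in> B" "b \<noteq> 0"
    "ideal C type_ring" "c \<in> C" "c \<noteq> 0" "A \<cdot>\<^bsub>type_ring\<^esub> B = A \<cdot>\<^bsub>type_ring\<^esub> C"
  shows "B = C"
  using dedekind_domain.ideal_prod_cancel[OF dedekind assms(1) _ assms(4) _ assms(7)]
    assms by auto

text \<open>Everything rests on cancellation of ideals. For \<open>G = xR + P\<close> it is shown
  that \<open>P G = P\<close>, so \<open>G\<close> is the whole ring. That \<open>P\<close> is
  contained in \<open>P G\<close> comes from the claim \<open>divisor\<close>: each nonzero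
  \<open>q'\<close> in \<open>P\<close> lies in \<open>q' P + x P\<close>.\<close>

lemma primeideal_maximal:
  fixes P :: "'a set"
  assumes P: "primeideal P type_ring" and q: "q \<in> P" "q \<noteq> 0" and x: "x \<notin> P"
  shows "\<exists>r p. p \<in> P \<and> r * x + p = 1"
proof -
  note idP = primeideal_ideal[OF P]
  have x0: "x \<noteq> 0" using x ideal_zero[OF idP] by auto
  have divisor: "\<exists>y p. y \<in> P \<and> p \<in> P \<and> q' = q' * p + x * y" if q': "q' \<in> P" "q' \<noteq> 0" for q'
  proof -
    let ?I = "ideal2 q' x" and ?K = "ideal2 (q' * q') (x * x)"
    let ?II = "?I \<cdot>\<^bsub>type_ring\<^esub> ?I"
    have II: "ideal ?II type_ring" by (intro ideal_prod_type_ring_ideal ideal2_ideal)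
    have K: "?K \<subseteq> ?II"
      by (intro ideal2_subset II ideal_prod_mem ideal2_gens)
    \<comment> \<open>\<open>I\<^sup>3 = I (q\<^sup>2, x\<^sup>2)\<close> for \<open>I = (q, x)\<close>, so cancelling \<open>I\<close> puts \<open>q x\<close> into \<open>(q\<^sup>2, x\<^sup>2)\<close>\<close>
    have "?I \<cdot>\<^bsub>type_ring\<^esub> ?II = ?I \<cdot>\<^bsub>type_ring\<^esub> ?K"
    proof
      let ?IK = "?I \<cdot>\<^bsub>type_ring\<^esub> ?K"
      have IK: "ideal ?IK type_ring" by (intro ideal_prod_type_ring_ideal ideal2_ideal)
      have mem: "q' * (q' * q') \<in> ?IK" "q' * (x * x) \<in> ?IK" "x * (q' * q') \<in> ?IK" "x * (x * x) \<in> ?IK"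
        by (intro ideal_prod_mem ideal2_gens)+
      have "?II \<subseteq> {j. q' * j \<in> ?IK \<and> x * j \<in> ?IK}"
      proof (rule ideal_prod_type_ring_subset)
        show "ideal {j. q' * j \<in> ?IK \<and> x * j \<in> ?IK} type_ring"
          using IK by (auto simp: ideal_type_ring_iff algebra_simps)
        fix i j assume "i \<in> ?I" "j \<in> ?I"
        then obtain r s t u where ij: "i = r * q' + s * x" "j = t * q' + u * x"
          by (auto simp: ideal2_def)
        have "q' * (i * j) = (r * t) * (q' * (q' * q')) + (r * u + s * t) * (x * (q' * q'))
            + (s * u) * (q' * (x * x))"
          "x * (i * j) = (r * t) * (x * (q' * q')) + (r * u + s * t) * (q' * (x * x))
            + (s * u) * (x * (x * x))"
          by (simp_all add: ij algebra_simps)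
        then show "i * j \<in> {j. q' * j \<in> ?IK \<and> x * j \<in> ?IK}"
          using mem by (simp add: ideal_intros[OF IK])
      qed
      then show "?I \<cdot>\<^bsub>type_ring\<^esub> ?II \<subseteq> ?IK"
        by (intro ideal2_prod_subset[OF IK]) auto
      show "?IK \<subseteq> ?I \<cdot>\<^bsub>type_ring\<^esub> ?II"
        using K by (intro ideal2_prod_subset ideal_prod_type_ring_ideal ideal2_ideal)
          (auto intro!: ideal_prod_mem ideal2_gens)
    qed
    moreover have "q' * q' \<in> ?II" "q' * q' \<noteq> 0"
      using q'(2) by (auto intro!: ideal_prod_mem ideal2_gens)
    ultimately have "?II = ?K"
      using type_ring_ideal_prod_cancel[OF ideal2_ideal ideal2_gens(1) q'(2) II _ _ ideal2_ideal ideal2_gens(1)] by blast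
    then have "q' * x \<in> ?K"
      using ideal_prod_mem[OF ideal2_gens(1)[of q' x] ideal2_gens(2)[of x q']] by (simp only:)
    then obtain s y where sy: "q' * x = s * (q' * q') + y * (x * x)"
      by (auto simp: ideal2_def)
    have y: "y \<in> P"
    proof -
      have "y * (x * x) = q' * x - s * (q' * q')" using sy by simp
      then have "y * (x * x) \<in> P" using q'(1) by (simp add: ideal_intros[OF idP])
      then show ?thesis using x by (simp add: primeideal_mult_iff[OF P])
    qed
    \<comment> \<open>\<open>y x / q\<close> is integral over the ring; cancelling \<open>J\<close> shows that it belongs to the ring\<close>
    let ?J = "ideal2 q' (y * x)" and ?q = "ideal2 q' 0"
    have JJ: "ideal (?J \<cdot>\<^bsub>type_ring\<^esub> ?J) type_ring" "ideal (?J \<cdot>\<^bsub>type_ring\<^esub> ?q) type_ring"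
      by (intro ideal_prod_type_ring_ideal ideal2_ideal)+
    have "?J \<cdot>\<^bsub>type_ring\<^esub> ?J = ?J \<cdot>\<^bsub>type_ring\<^esub> ?q"
    proof
      have mem: "q' * q' \<in> ?J \<cdot>\<^bsub>type_ring\<^esub> ?q" "y * x * q' \<in> ?J \<cdot>\<^bsub>type_ring\<^esub> ?q"
        by (intro ideal_prod_mem ideal2_gens)+
      show "?J \<cdot>\<^bsub>type_ring\<^esub> ?J \<subseteq> ?J \<cdot>\<^bsub>type_ring\<^esub> ?q"
      proof (rule ideal2_prod_subset[OF JJ(2)])
        fix j assume "j \<in> ?J"
        then obtain t u where j: "j = t * q' + u * (y * x)" by (auto simp: ideal2_def)
        have "q' * j = t * (q' * q') + u * (y * x * q')" by (simp add: j algebra_simps)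
        then show "q' * j \<in> ?J \<cdot>\<^bsub>type_ring\<^esub> ?q" using mem by (simp add: ideal_intros[OF JJ(2)])
        have "y * (q' * x) = y * (s * (q' * q')) + y * (y * (x * x))"
          unfolding sy by (rule distrib_left)
        then have "y * x * (y * x) = y * x * q' - (y * s) * (q' * q')"
          by (simp add: algebra_simps)
        moreover have "y * x * j = t * (y * x * q') + u * (y * x * (y * x))"
          by (simp add: j algebra_simps)
        ultimately have "y * x * j = t * (y * x * q') + u * (y * x * q' - (y * s) * (q' * q'))"
          by simp
        then show "y * x * j \<in> ?J \<cdot>\<^bsub>type_ring\<^esub> ?q" using mem by (simp add: ideal_intros[OF JJ(2)])
      qed
      have "?q \<subseteq> ?J" by (intro ideal2_subset ideal2_ideal ideal2_gens ideal_zero)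
      then show "?J \<cdot>\<^bsub>type_ring\<^esub> ?q \<subseteq> ?J \<cdot>\<^bsub>type_ring\<^esub> ?J"
        by (intro ideal2_prod_subset[OF JJ(1)]) (auto intro!: ideal_prod_mem ideal2_gens)
    qed
    then have "?J = ?q"
      using type_ring_ideal_prod_cancel[OF ideal2_ideal ideal2_gens(1) q'(2) ideal2_ideal ideal2_gens(1) q'(2)
          ideal2_ideal ideal2_gens(1) q'(2)] by blast
    then have "q' dvd y * x" using ideal2_gens(2)[of "y * x" q'] by (simp only: ideal2_zero_iff)
    then obtain u where u: "y * x = q' * u" by (auto simp: dvd_def)
    have "y * (x * x) = q' * u * x" by (simp only: u mult.assoc[symmetric])
    then have "q' * x = q' * (s * q' + u * x)" using sy by (simp add: algebra_simps)
    then have "x = s * q' + u * x" using q'(2) mult_left_cancel by blast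
    \<comment> \<open>Hence \<open>u\<close> is 1 modulo \<open>P\<close>, and
      \<open>q' u = x y\<close> yields the required decomposition of \<open>q'\<close>.\<close>
    then have "x * (1 - u) = s * q'" by (simp add: algebra_simps)
    then have "x * (1 - u) \<in> P" using q'(1) by (simp add: ideal_intros[OF idP])
    then have "1 - u \<in> P" using x by (simp add: primeideal_mult_iff[OF P])
    moreover have "q' = q' * (1 - u) + x * y" using u by (simp add: algebra_simps)
    ultimately show ?thesis using y by blast
  qed
  define G where "G = {r * x + p | r p. p \<in> P}"
  have G: "ideal G type_ring"
  proof -
    have "0 = 0 * x + 0" by simp
    moreover have "(r * x + p) + (r' * x + p') = (r + r') * x + (p + p')"
      "t * (r * x + p) = (t * r) * x + t * p" for r p r' p' t
      by (simp_all add: algebra_simps)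
    ultimately show ?thesis
      unfolding ideal_type_ring_iff G_def using ideal_intros(1-3)[OF idP] by blast
  qed
  have xG: "x \<in> G" and PG: "P \<subseteq> G"
  proof -
    have "x = 1 * x + 0" "p = 0 * x + p" for p by simp_all
    then show "x \<in> G" "P \<subseteq> G" unfolding G_def using ideal_zero[OF idP] by blast+
  qed
  have UN: "ideal UNIV (type_ring :: 'a ring)" by (simp add: ideal_type_ring_iff)
  have PG_ideal: "ideal (P \<cdot>\<^bsub>type_ring\<^esub> G) type_ring" by (intro ideal_prod_type_ring_ideal idP G)
  have "P \<cdot>\<^bsub>type_ring\<^esub> G = P \<cdot>\<^bsub>type_ring\<^esub> UNIV"
  proof
    show "P \<cdot>\<^bsub>type_ring\<^esub> G \<subseteq> P \<cdot>\<^bsub>type_ring\<^esub> UNIV"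
      by (intro ideal_prod_type_ring_subset ideal_prod_type_ring_ideal idP UN ideal_prod_mem) auto
    have "q' \<in> P \<cdot>\<^bsub>type_ring\<^esub> G" if q': "q' \<in> P" for q'
    proof (cases "q' = 0")
      case False
      obtain y p where yp: "y \<in> P" "p \<in> P" "q' = q' * p + y * x"
        using divisor[OF q' False] by (auto simp: mult.commute)
      have "q' * p \<in> P \<cdot>\<^bsub>type_ring\<^esub> G" "y * x \<in> P \<cdot>\<^bsub>type_ring\<^esub> G"
        using q' yp(1,2) xG PG by (auto intro!: ideal_prod_mem)
      then show ?thesis by (subst yp(3)) (rule ideal_add[OF PG_ideal])
    qed (simp add: ideal_zero[OF PG_ideal])
    then show "P \<cdot>\<^bsub>type_ring\<^esub> UNIV \<subseteq> P \<cdot>\<^bsub>type_ring\<^esub> G"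
      by (intro ideal_prod_type_ring_subset PG_ideal ideal_mult_right[OF PG_ideal])
  qed
  then have "G = UNIV" using type_ring_ideal_prod_cancel[OF idP q G xG x0 UN UNIV_I one_neq_zero] by simp
  then have "1 \<in> G" by simp
  then obtain r p where "p \<in> P" "1 = r * x + p" unfolding G_def by blast
  then show ?thesis by (intro exI[of _ r] exI[of _ p]) simp
qed

text \<open>The prime \<open>P'\<close> split off by \<open>prime_factor_below_primeideal\<close> is
  nonzero, hence maximal, and it lies in the proper ideal \<open>P\<close>, so the two
  agree.\<close>

lemma primeideal_divides:
  fixes P :: "'a set"
  assumes P: "primeideal P type_ring" and A: "ideal A type_ring" "a \<in> A" "a \<noteq> 0" "A \<subseteq> P"
  shows "\<exists>C. ideal C type_ring \<and> A = P \<cdot>\<^bsub>type_ring\<^esub> C"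
proof -
  have "A \<noteq> {\<zero>\<^bsub>type_ring\<^esub>}" using A by auto
  from dedekind_domain.prime_factor_below_primeideal[OF dedekind A(1) this P A(4)]
  obtain P' C where P': "primeideal P' type_ring" "P' \<noteq> {0}" "P' \<subseteq> P" and C: "ideal C type_ring"
    and eq: "A = P' \<cdot>\<^bsub>type_ring\<^esub> C" by auto
  obtain q where q: "q \<in> P'" "q \<noteq> 0"
    using P'(2) ideal_zero[OF primeideal_ideal[OF P'(1)]] by blast
  have "P \<subseteq> P'"
  proof (rule ccontr)
    assume "\<not> P \<subseteq> P'"
    then obtain x where x: "x \<in> P" "x \<notin> P'" by blast
    obtain r p where rp: "p \<in> P'" "r * x + p = 1" using primeideal_maximal[OF P'(1) q x(2)] by blast
    then have "r * x + p \<in> P"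
      using P'(3) x(1) primeideal_ideal[OF P] by (intro ideal_add ideal_mult_left) auto
    then show False using P by (simp add: rp(2) primeideal_type_ring_iff)
  qed
  then have "P' = P" using P'(3) by blast
  then show ?thesis using C eq by blast
qed

text \<open>An element outside \<open>P\<close> is invertible modulo \<open>P\<close>, hence modulo
  \<open>P^2\<close>: squaring \<open>r * s + p = 1\<close> leaves \<open>p * p\<close> plus a
  multiple of \<open>s\<close>.\<close>

lemma primeideal_square_primary:
  fixes P :: "'a set"
  assumes P: "primeideal P type_ring" "P \<noteq> {0}" and s: "s \<notin> P" "s * d \<in> P \<cdot>\<^bsub>type_ring\<^esub> P"
  shows "d \<in> P \<cdot>\<^bsub>type_ring\<^esub> P"
proof -
  have PP: "ideal (P \<cdot>\<^bsub>type_ring\<^esub> P) type_ring"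
    by (intro ideal_prod_type_ring_ideal primeideal_ideal P)
  obtain q where "q \<in> P" "q \<noteq> 0"
    using P(2) ideal_zero[OF primeideal_ideal[OF P(1)]] by blast
  then obtain r p where rp: "p \<in> P" "r * s + p = 1"
    using primeideal_maximal[OF P(1)] s(1) by blast
  have "d = (r * s + p) * (r * s + p) * d" by (simp add: rp(2))
  also have "\<dots> = (r * r * s + 2 * r * p) * (s * d) + d * (p * p)" by (simp add: algebra_simps)
  finally have eq: "d = (r * r * s + 2 * r * p) * (s * d) + d * (p * p)" .
  show ?thesis
    by (subst eq) (intro ideal_add ideal_mult_left PP s(2) ideal_prod_mem rp(1))
qed

text \<open>Division by \<open>P\<close> is carried out twice. The first quotient \<open>D\<close>,
  with \<open>dR = P D\<close>, lies in \<open>P\<close> again, by cancellation.\<close>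

lemma primeideal_square_divides:
  fixes P :: "'a set"
  assumes P: "primeideal P type_ring" and d: "d \<in> P \<cdot>\<^bsub>type_ring\<^esub> P"
  shows "\<exists>C. ideal C type_ring \<and> ideal2 d 0 = (P \<cdot>\<^bsub>type_ring\<^esub> P) \<cdot>\<^bsub>type_ring\<^esub> C"
proof (cases "d = 0")
  case True
  interpret ring "type_ring :: 'a ring" by (rule ring_from_type_algebra)
  \<comment> \<open>Cancellation requires nonzero ideals, so \<open>d = 0\<close> is treated apart,
    with the zero ideal as complementary factor.\<close>
  have zero: "ideal {0} (type_ring :: 'a ring)" by (simp add: ideal_type_ring_iff)
  have "(P \<cdot>\<^bsub>type_ring\<^esub> P) \<cdot>\<^bsub>type_ring\<^esub> {0} = {0}"
    using ideal_prod_zero[OF ideal_prod_type_ring_ideal[OF primeideal_ideal[OF P] primeideal_ideal[OF P]]]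
    by simp
  moreover have "ideal2 d 0 = {0}" using True by (auto simp: ideal2_zero_iff)
  ultimately show ?thesis using zero by (intro exI[of _ "{0}"]) simp
next
  case False
  interpret ring "type_ring :: 'a ring" by (rule ring_from_type_algebra)
  note idP = primeideal_ideal[OF P]
  have PP: "ideal (P \<cdot>\<^bsub>type_ring\<^esub> P) type_ring" by (intro ideal_prod_type_ring_ideal idP)
  have "P \<cdot>\<^bsub>type_ring\<^esub> P \<subseteq> P" using ideal_prod_inter[OF idP idP] by blast
  then have dP: "d \<in> P" using d by blast
  obtain D where D: "ideal D type_ring" "ideal2 d 0 = P \<cdot>\<^bsub>type_ring\<^esub> D"
    using primeideal_divides[OF P ideal2_ideal ideal2_gens(1) False]
      ideal2_subset[OF idP dP ideal_zero[OF idP]] by blast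
  obtain d' where d': "d' \<in> D" "d' \<noteq> 0"
  proof -
    have "D \<noteq> {0}"
    proof
      assume "D = {0}"
      then have "ideal2 d 0 = {0}" using D(2) ideal_prod_zero[OF idP] by simp
      then show False using ideal2_gens(1)[of d 0] False by simp
    qed
    then show ?thesis using that ideal_zero[OF D(1)] by blast
  qed
  have "D \<subseteq> P"
  proof
    fix c assume c: "c \<in> D"
    \<comment> \<open>\<open>?E\<close> is \<open>P + cR\<close>. Since \<open>P c\<close> lies in
      \<open>P D = dR\<close> and so in \<open>P^2\<close>, multiplying \<open>?E\<close> by
      \<open>P\<close> gives \<open>P^2\<close>, and cancelling \<open>P\<close> gives
      \<open>?E = P\<close>.\<close>
    let ?E = "{p + r * c | p r. p \<in> P}"
    have E: "ideal ?E type_ring"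
    proof -
      have "0 = 0 + 0 * c" by simp
      moreover have "(p + r * c) + (p' + r' * c) = (p + p') + (r + r') * c"
        "t * (p + r * c) = t * p + (t * r) * c" for r p r' p' t
        by (simp_all add: algebra_simps)
      ultimately show ?thesis
        unfolding ideal_type_ring_iff using ideal_intros(1-3)[OF idP] by blast
    qed
    have PE: "p \<in> ?E" if "p \<in> P" for p
    proof -
      have "p = p + 0 * c" by simp
      then show ?thesis using that by blast
    qed
    have cE: "c \<in> ?E"
    proof -
      have "c = 0 + 1 * c" by simp
      then show ?thesis using ideal_zero[OF idP] by blast
    qed
    have cP: "p * c \<in> P \<cdot>\<^bsub>type_ring\<^esub> P" if "p \<in> P" for p
      using ideal_prod_mem[OF that c] ideal2_subset[OF PP d ideal_zero[OF PP]] D(2) by blast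
    have "P \<cdot>\<^bsub>type_ring\<^esub> ?E = P \<cdot>\<^bsub>type_ring\<^esub> P"
    proof
      show "P \<cdot>\<^bsub>type_ring\<^esub> ?E \<subseteq> P \<cdot>\<^bsub>type_ring\<^esub> P"
      proof (rule ideal_prod_type_ring_subset[OF PP])
        fix i j assume i: "i \<in> P" and "j \<in> ?E"
        then obtain p r where j: "p \<in> P" "j = p + r * c" by blast
        have "i * j = i * p + r * (i * c)" by (simp add: j(2) algebra_simps)
        moreover have "i * p \<in> P \<cdot>\<^bsub>type_ring\<^esub> P" "r * (i * c) \<in> P \<cdot>\<^bsub>type_ring\<^esub> P"
          using ideal_prod_mem[OF i j(1)] ideal_mult_left[OF PP cP[OF i]] by blast+
        ultimately show "i * j \<in> P \<cdot>\<^bsub>type_ring\<^esub> P" using ideal_add[OF PP] by simp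
      qed
      show "P \<cdot>\<^bsub>type_ring\<^esub> P \<subseteq> P \<cdot>\<^bsub>type_ring\<^esub> ?E"
        by (intro ideal_prod_type_ring_subset ideal_prod_type_ring_ideal idP E ideal_prod_mem PE)
    qed
    then have "?E = P"
      using type_ring_ideal_prod_cancel[OF idP dP False E PE[OF dP] False idP dP False] by simp
    then show "c \<in> P" using cE by blast
  qed
  then obtain C where C: "ideal C type_ring" "D = P \<cdot>\<^bsub>type_ring\<^esub> C"
    using primeideal_divides[OF P D(1) d'] by blast
  then have "ideal2 d 0 = (P \<cdot>\<^bsub>type_ring\<^esub> P) \<cdot>\<^bsub>type_ring\<^esub> C"
    unfolding D(2) ideal_prod_assoc[OF idP idP C(1)] by simp
  then show ?thesis using C(1) by blast
qed

end

section \<open>Determinants of symmetric matrices\<close>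

lemma cofactor_transpose:
  assumes "M \<in> carrier_mat n n" "i < n" "j < n"
  shows "cofactor (transpose_mat M) i j = cofactor M j i"
proof -
  have "mat_delete (transpose_mat M) i j = transpose_mat (mat_delete M j i)"
    using assms by (intro eq_matI) (auto simp: mat_delete_def)
  moreover have "mat_delete M j i \<in> carrier_mat (n - 1) (n - 1)"
    using mat_delete_carrier[OF assms(1)] .
  ultimately show ?thesis by (simp add: cofactor_def det_transpose add.commute)
qed

text \<open>A nonzero isotropic kernel vector \<open>w\<close> of a symmetric matrix forces the adjugate to be a
  multiple of \<open>w w\<^sup>T\<close>, whose trace vanishes.\<close>
lemma trace_adjugate_mem_primeideal:
  fixes M :: "'a::comm_ring_1 mat"
  assumes P: "primeideal P type_ring" and M: "M \<in> carrier_mat n n" "transpose_mat M = M"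
    and ker: "\<And>i. i < n \<Longrightarrow> (\<Sum>j<n. M $$ (i, j) * w j) \<in> P"
    and iso: "(\<Sum>i<n. w i * w i) \<in> P" and m: "m < n" "w m \<notin> P"
  shows "(\<Sum>k<n. cofactor M k k) \<in> P"
proof -
  note idP = primeideal_ideal[OF P]
  have minors: "w k * cofactor M l i - w i * cofactor M l k \<in> P" if ikl: "i < n" "k < n" "l < n" for i k l
  proof -
    \<comment> \<open>The row \<open>c\<close> is orthogonal to \<open>w\<close>, so putting it in
      place of row \<open>l\<close> keeps \<open>w\<close> in the kernel modulo \<open>P\<close>.
      Expanding \<open>det N\<close> along this row gives the claimed difference.\<close>
    define c where "c = (\<lambda>j. (if j = i then w k else 0) - (if j = k then w i else 0))"
    define N where "N = mat n n (\<lambda>(r, j). if r = l then c j else M $$ (r, j))"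
    have N: "N \<in> carrier_mat n n" by (simp add: N_def)
    have "(\<Sum>j<n. N $$ (r, j) * w j) \<in> P" if r: "r < n" for r
    proof (cases "r = l")
      case True
      have "(\<Sum>j<n. N $$ (r, j) * w j) =
          (\<Sum>j<n. (if j = i then w k * w j else 0) - (if j = k then w i * w j else 0))"
        using True r by (intro sum.cong) (auto simp: N_def c_def left_diff_distrib)
      also have "\<dots> = 0" using ikl by (simp add: sum_subtractf)
      finally show ?thesis by (simp add: ideal_zero[OF idP])
    next
      case False
      then have "(\<Sum>j<n. N $$ (r, j) * w j) = (\<Sum>j<n. M $$ (r, j) * w j)"
        using r by (intro sum.cong) (auto simp: N_def)
      then show ?thesis using ker[OF r] by simp
    qed
    note Nw = this
    have "(\<Sum>r<n. adj_mat N $$ (m, r) * (\<Sum>j<n. N $$ (r, j) * w j)) \<in> P"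
      by (rule ideal_sum[OF idP], rule ideal_mult_left[OF idP]) (simp add: Nw)
    \<comment> \<open>Multiplying \<open>N w\<close> by the adjugate of \<open>N\<close> gives
      \<open>det N\<close> times \<open>w\<close>; coordinate \<open>m\<close> is the one where
      \<open>w\<close> can be cancelled modulo \<open>P\<close>.\<close>
    also have "(\<Sum>r<n. adj_mat N $$ (m, r) * (\<Sum>j<n. N $$ (r, j) * w j)) =
        (\<Sum>j<n. (\<Sum>r<n. adj_mat N $$ (m, r) * N $$ (r, j)) * w j)"
      unfolding sum_distrib_left sum_distrib_right by (subst sum.swap) (simp add: mult.assoc)
    also have "\<dots> = (\<Sum>j<n. (adj_mat N * N) $$ (m, j) * w j)"
      using m N adj_mat(1)[OF N]
      by (intro sum.cong refl) (auto simp: scalar_prod_def atLeast0LessThan intro!: sum.cong)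
    also have "\<dots> = (\<Sum>j<n. if j = m then det N * w j else 0)"
      unfolding adj_mat(3)[OF N] using m by (intro sum.cong) auto
    also have "\<dots> = det N * w m" using m by simp
    finally have "det N \<in> P" using m(2) by (simp add: primeideal_mult_iff[OF P])
    moreover have "det N = (\<Sum>j<n. N $$ (l, j) * cofactor N l j)"
      by (rule laplace_expansion_row[OF N ikl(3)])
    moreover have "cofactor N l j = cofactor M l j" if "j < n" for j
    proof -
      have "mat_delete N l j = mat_delete M l j"
        using M N ikl that by (intro eq_matI) (auto simp: mat_delete_def N_def)
      then show ?thesis by (simp add: cofactor_def)
    qed
    moreover have "(\<Sum>j<n. N $$ (l, j) * cofactor M l j) =
        (\<Sum>j<n. (if j = i then w k * cofactor M l j else 0) - (if j = k then w i * cofactor M l j else 0))"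
      using ikl by (intro sum.cong) (auto simp: N_def c_def left_diff_distrib)
    ultimately show ?thesis using ikl by (simp add: sum_subtractf)
  qed
  \<comment> \<open>Two of the relations \<open>minors\<close>, joined by the symmetry of the
    cofactors, compare the diagonal entries of the adjugate with the squares of \<open>w\<close>.
    Summing over \<open>k\<close> then brings in isotropy.\<close>
  have summand: "w m * w m * cofactor M k k - cofactor M m m * (w k * w k) \<in> P" if k: "k < n" for k
  proof -
    have "cofactor M k m = cofactor M m k"
      using cofactor_transpose[OF M(1) k m(1)] M(2) by simp
    then have "w m * w m * cofactor M k k - cofactor M m m * (w k * w k) =
        w m * - (w k * cofactor M k m - w m * cofactor M k k) +
        w k * - (w k * cofactor M m m - w m * cofactor M m k)"
      by (simp add: algebra_simps)
    also have "\<dots> \<in> P"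
      using minors[OF m(1) k k] minors[OF m(1) k m(1)]
      by (intro ideal_add[OF idP] ideal_mult_left[OF idP] ideal_uminus[OF idP])
    finally show ?thesis .
  qed
  have "(\<Sum>k<n. w m * w m * cofactor M k k - cofactor M m m * (w k * w k)) \<in> P"
    using summand by (intro ideal_sum[OF idP]) auto
  also have "(\<Sum>k<n. w m * w m * cofactor M k k - cofactor M m m * (w k * w k)) =
      w m * w m * (\<Sum>k<n. cofactor M k k) - cofactor M m m * (\<Sum>k<n. w k * w k)"
    by (simp add: sum_subtractf sum_distrib_left)
  finally have "cofactor M m m * (\<Sum>k<n. w k * w k) +
      (w m * w m * (\<Sum>k<n. cofactor M k k) - cofactor M m m * (\<Sum>k<n. w k * w k)) \<in> P"
    using iso by (intro ideal_add[OF idP] ideal_mult_left[OF idP])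
  then show ?thesis using m(2) by (simp add: primeideal_mult_iff[OF P])
qed

text \<open>The derivative is the sum of the characteristic polynomials of the principal submatrices
  of size \<open>n - 1\<close>, which are the diagonal cofactors of \<open>x - A\<close>. It is thus
  the trace treated in \<open>trace_adjugate_mem_primeideal\<close>.\<close>

lemma pderiv_char_poly_cofactor:
  fixes A :: "'a::idom mat"
  assumes A: "A \<in> carrier_mat n n"
  shows "pderiv (char_poly A) = (\<Sum>k<n. cofactor (char_poly_matrix A) k k)"
proof -
  have "char_poly_matrix (mat_delete A k k) = mat_delete (char_poly_matrix A) k k" if "k < n" for k
    using A that by (intro eq_matI) (auto simp: char_poly_matrix_def mat_delete_def)
  then have "cofactor (char_poly_matrix A) k k = char_poly (mat_delete A k k)" if "k < n" for k
    using that by (simp add: cofactor_def char_poly_def power_add flip: power_mult_distrib)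
  then show ?thesis by (simp add: pderiv_char_poly[OF A])
qed

text \<open>The entries \<open>(i, j)\<close> with \<open>i = m\<close> or \<open>j = m\<close> lie in \<open>I\<close>; a permutation either fixes \<open>m\<close> or meets two
  of them.\<close>
lemma det_mem_if_cross_mem:
  fixes N :: "'a::comm_ring_1 mat"
  assumes N: "N \<in> carrier_mat n n" and m: "m < n" and J: "ideal J type_ring" 
    and IJ: "\<And>a b. \<lbrakk> a \<in> I; b \<in> I \<rbrakk> \<Longrightarrow> a * b \<in> J"
    and row: "\<And>j. \<lbrakk> j < n; j \<noteq> m \<rbrakk> \<Longrightarrow> N $$ (m, j) \<in> I"
    and col: "\<And>j. \<lbrakk> j < n; j \<noteq> m \<rbrakk> \<Longrightarrow> N $$ (j, m) \<in> I"
    and diag: "N $$ (m, m) \<in> J"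
  shows "det N \<in> J"
proof -
  have "(\<Prod>i=0..<n. N $$ (i, p i)) \<in> J" if p: "p permutes {0..<n}" for p
  proof (cases "p m = m")
    case True
    then have "(\<Prod>i=0..<n. N $$ (i, p i)) = N $$ (m, m) * (\<Prod>i\<in>{0..<n} - {m}. N $$ (i, p i))"
      using m by (subst prod.remove[of _ m]) auto
    then show ?thesis using diag by (simp add: ideal_mult_right[OF J])
  next
    case False
    \<comment> \<open>Row \<open>l\<close> supplies the second cross entry, the one in column
      \<open>m\<close>.\<close>
    obtain l where pl: "p l = m" using permutes_surj[OF p] by (metis surjD)
    have l: "l < n" "l \<noteq> m"
      using permutes_in_image[OF p, of l] pl m False by auto
    have pm: "p m < n" using permutes_in_image[OF p, of m] m by auto
    have "(\<Prod>i=0..<n. N $$ (i, p i)) =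
        N $$ (m, p m) * (N $$ (l, m) * (\<Prod>i\<in>{0..<n} - {m} - {l}. N $$ (i, p i)))"
      using m l pl by (subst prod.remove[of _ m], simp, simp, subst prod.remove[of _ l]) auto
    then have "(\<Prod>i=0..<n. N $$ (i, p i)) =
        N $$ (m, p m) * N $$ (l, m) * (\<Prod>i\<in>{0..<n} - {m} - {l}. N $$ (i, p i))"
      by (simp add: mult.assoc)
    moreover have "N $$ (m, p m) * N $$ (l, m) \<in> J"
      using IJ row[OF pm False] col[OF l] by blast
    ultimately show ?thesis by (simp add: ideal_mult_right[OF J])
  qed
  then show ?thesis
    unfolding det_def'[OF N] by (intro ideal_sum[OF J] ideal_mult_left[OF J]) simp
qed

text \<open>Let \<open>T\<close> be the identity matrix with column \<open>m\<close> replaced by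
  \<open>v\<close>. Then \<open>T^T N T\<close> has determinant \<open>(v m)^2 * det N\<close>; its
  cross at \<open>m\<close> consists of entries of \<open>N v\<close> off the diagonal and of
  \<open>v^T N v\<close> on it.\<close>

lemma square_times_det_mem:
  fixes N :: "'a::comm_ring_1 mat"
  assumes N: "N \<in> carrier_mat n n" "transpose_mat N = N" and m: "m < n"
    and I: "ideal I type_ring" and J: "ideal J type_ring"
    and IJ: "\<And>a b. \<lbrakk> a \<in> I; b \<in> I \<rbrakk> \<Longrightarrow> a * b \<in> J"
    and ker: "\<And>i. i < n \<Longrightarrow> (\<Sum>j<n. N $$ (i, j) * v j) \<in> I"
    and iso: "(\<Sum>i<n. v i * (\<Sum>j<n. N $$ (i, j) * v j)) \<in> J"
  shows "v m * v m * det N \<in> J"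
proof -
  define x where "x = vec n v"
  have x: "x \<in> carrier_vec n" by (simp add: x_def)
  have xi: "x $ i = v i" if "i < n" for i using that by (simp add: x_def)
  have sym: "N $$ (i, j) = N $$ (j, i)" if "i < n" "j < n" for i j
    using N that by (metis carrier_matD index_transpose_mat(1))
  have mult_vec: "row L i \<bullet> x = (\<Sum>j<n. L $$ (i, j) * v j)" if "L \<in> carrier_mat n n" "i < n" for L i
    using that by (auto simp: scalar_prod_def x_def atLeast0LessThan intro!: sum.cong)
  \<comment> \<open>\<open>N1\<close> is \<open>T^T N\<close>, written as a transpose by symmetry of
    \<open>N\<close>, and \<open>N2\<close> is \<open>N1 T\<close>. By Cramer's rule each
    replacement contributes a factor \<open>v m\<close>.\<close>
  define N1 where "N1 = transpose_mat (replace_col N (N *\<^sub>v x) m)"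
  define N2 where "N2 = replace_col N1 (N1 *\<^sub>v x) m"
  have N1: "N1 \<in> carrier_mat n n" using N by (simp add: N1_def replace_col_def)
  have N2: "N2 \<in> carrier_mat n n" using N1 by (simp add: N2_def replace_col_def)
  have "replace_col N (N *\<^sub>v x) m \<in> carrier_mat n n" using N by (simp add: replace_col_def)
  then have "det N1 = v m * det N"
    unfolding N1_def using cramer_lemma_mat[OF N(1) x m] xi[OF m] by (simp add: det_transpose)
  then have det: "det N2 = v m * v m * det N"
    unfolding N2_def using N1 m x by (simp add: cramer_lemma_mat xi mult.assoc)
  have N1_index: "N1 $$ (i, j) = (if i = m then (\<Sum>k<n. N $$ (j, k) * v k) else N $$ (i, j))"
    if "i < n" "j < n" for i j
    using that N sym[OF that] by (simp add: N1_def replace_col_def mult_vec)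
  have N2_index: "N2 $$ (i, j) = (if j = m then (\<Sum>k<n. N1 $$ (i, k) * v k) else N1 $$ (i, j))"
    if "i < n" "j < n" for i j
    using that N1 by (simp add: N2_def replace_col_def mult_vec)
  have "det N2 \<in> J"
  proof (rule det_mem_if_cross_mem[OF N2 m J, of I])
    show "N2 $$ (m, j) \<in> I" if "j < n" "j \<noteq> m" for j
      using that m ker by (simp add: N1_index N2_index)
    show "N2 $$ (j, m) \<in> I" if "j < n" "j \<noteq> m" for j
      using that m ker by (simp add: N1_index N2_index)
    have "N2 $$ (m, m) = (\<Sum>i<n. v i * (\<Sum>j<n. N $$ (i, j) * v j))"
      using m by (simp add: N1_index N2_index mult.commute)
    then show "N2 $$ (m, m) \<in> J" using iso by simp
  qed (rule IJ)
  then show ?thesis by (simp add: det)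
qed

section \<open>Polynomials in a matrix\<close>

text \<open>Vectors of length \<open>n\<close> are functions on \<open>nat\<close>, of which only the values below \<open>n\<close> matter.\<close>

definition mat_apply :: "nat \<Rightarrow> 'a::comm_ring_1 mat \<Rightarrow> (nat \<Rightarrow> 'a) \<Rightarrow> nat \<Rightarrow> 'a" where
  "mat_apply n A v = (\<lambda>i. \<Sum>j<n. A $$ (i, j) * v j)"

text \<open>Powers act by iterating \<open>mat_apply\<close>, so the calculus below is free of
  dimension conditions; \<open>poly_mat_apply\<close> makes the link to
  \<open>poly_mat\<close>.\<close>

definition poly_apply :: "nat \<Rightarrow> 'a::comm_ring_1 mat \<Rightarrow> 'a poly \<Rightarrow> (nat \<Rightarrow> 'a) \<Rightarrow> nat \<Rightarrow> 'a" where
  "poly_apply n A p v = (\<lambda>i. \<Sum>k\<le>degree p. coeff p k * (mat_apply n A ^^ k) v i)"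

lemma mat_apply_linear:
  "mat_apply n A (\<lambda>i. \<Sum>s\<in>S. c s * u s i) i = (\<Sum>s\<in>S. c s * mat_apply n A (u s) i)"
  unfolding mat_apply_def sum_distrib_left
  by (subst sum.swap) (simp add: mult.left_commute)

lemma poly_apply_bound:
  assumes "degree p \<le> N"
  shows "poly_apply n A p v i = (\<Sum>k\<le>N. coeff p k * (mat_apply n A ^^ k) v i)"
  unfolding poly_apply_def using assms
  by (intro sum.mono_neutral_left) (auto simp: coeff_eq_0)

lemma poly_apply_0 [simp]: "poly_apply n A 0 v i = 0"
  by (simp add: poly_apply_def)

lemma poly_apply_add: "poly_apply n A (p + q) v i = poly_apply n A p v i + poly_apply n A q v i"
proof -
  let ?N = "max (degree p) (degree q)"
  have "degree (p + q) \<le> ?N" by (rule degree_add_le_max)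
  then show ?thesis
    by (simp add: poly_apply_bound[of _ ?N] distrib_right sum.distrib)
qed

lemma poly_apply_smult: "poly_apply n A (smult c p) v i = c * poly_apply n A p v i"
  by (simp add: poly_apply_bound[of _ "degree p"] degree_smult_le sum_distrib_left mult.assoc)

lemma poly_apply_diff: "poly_apply n A (p - q) v i = poly_apply n A p v i - poly_apply n A q v i"
  using poly_apply_add[of n A p "- q" v i] poly_apply_smult[of n A "- 1" q v i] by simp

lemma poly_apply_sum: "poly_apply n A (sum p S) v i = (\<Sum>s\<in>S. poly_apply n A (p s) v i)"
  by (induction S rule: infinite_finite_induct) (auto simp: poly_apply_add)

lemma poly_apply_pCons:
  "poly_apply n A (pCons a p) v i = a * v i + mat_apply n A (poly_apply n A p v) i"
proof -
  have "poly_apply n A (pCons a p) v i =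
      (\<Sum>k\<le>Suc (degree p). coeff (pCons a p) k * (mat_apply n A ^^ k) v i)"
    by (rule poly_apply_bound) (rule degree_pCons_le)
  also have "\<dots> = a * v i + (\<Sum>k\<le>degree p. coeff p k * mat_apply n A ((mat_apply n A ^^ k) v) i)"
    by (subst sum.atMost_Suc_shift) simp
  also have "(\<Sum>k\<le>degree p. coeff p k * mat_apply n A ((mat_apply n A ^^ k) v) i) =
      mat_apply n A (poly_apply n A p v) i"
    unfolding poly_apply_def by (rule mat_apply_linear[symmetric])
  finally show ?thesis .
qed

text \<open>Horner's rule \<open>poly_apply_pCons\<close> carries the induction. Vectors thereby
  form a module over the polynomial ring, and annihilators modulo \<open>P\<close> become ideals of
  it.\<close>

lemma poly_apply_mult: "poly_apply n A (p * q) v = poly_apply n A p (poly_apply n A q v)"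
proof (induction p)
  case 0
  then show ?case by (simp add: fun_eq_iff)
next
  case (pCons a p)
  show ?case
    by (rule ext) (simp add: poly_apply_add poly_apply_smult poly_apply_pCons pCons.IH)
qed

lemma poly_apply_linear:
  "poly_apply n A p (\<lambda>i. \<Sum>s\<in>S. c s * u s i) i = (\<Sum>s\<in>S. c s * poly_apply n A p (u s) i)"
proof (induction p arbitrary: i)
  case (pCons a p)
  have "mat_apply n A (\<lambda>i. \<Sum>s\<in>S. c s * poly_apply n A p (u s) i) i =
      (\<Sum>s\<in>S. c s * mat_apply n A (poly_apply n A p (u s)) i)"
    by (rule mat_apply_linear)
  moreover have "poly_apply n A p (\<lambda>i. \<Sum>s\<in>S. c s * u s i) =
      (\<lambda>i. \<Sum>s\<in>S. c s * poly_apply n A p (u s) i)"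
    using pCons.IH by blast
  ultimately show ?case
    by (simp add: poly_apply_pCons sum.distrib sum_distrib_left distrib_left mult.left_commute)
qed simp

lemma poly_apply_cong:
  assumes "\<And>i. i < n \<Longrightarrow> u i = v i" "i < n"
  shows "poly_apply n A p u i = poly_apply n A p v i"
  using assms(2)
proof (induction p arbitrary: i)
  case (pCons a p)
  have "mat_apply n A (poly_apply n A p u) i = mat_apply n A (poly_apply n A p v) i"
    unfolding mat_apply_def using pCons.IH by (intro sum.cong) auto
  then show ?case using assms(1)[OF pCons.prems] by (simp add: poly_apply_pCons)
qed simp

lemma poly_apply_mem_ideal:
  assumes I: "ideal I type_ring" and "\<And>i. i < n \<Longrightarrow> v i \<in> I" "i < n"
  shows "poly_apply n A p v i \<in> I"
  using assms(3)
proof (induction p arbitrary: i)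
  case (pCons a p)
  have "mat_apply n A (poly_apply n A p v) i \<in> I"
    unfolding mat_apply_def using pCons.IH
    by (intro ideal_sum[OF I] ideal_mult_left[OF I]) auto
  then show ?case
    using assms(2)[OF pCons.prems] by (simp add: poly_apply_pCons ideal_intros[OF I])
qed (simp add: ideal_zero[OF I])

lemma poly_apply_mem_ideal_coeff:
  assumes I: "ideal I type_ring" and "\<And>k. coeff p k \<in> I"
  shows "poly_apply n A p v i \<in> I"
  unfolding poly_apply_def by (intro ideal_sum[OF I] ideal_mult_right[OF I] assms(2))

text \<open>Each step of Horner's rule is one instance of the closure hypothesis.\<close>

lemma poly_apply_closed:
  assumes "(\<lambda>_. 0) \<in> V" "\<And>u v a. \<lbrakk> u \<in> V; v \<in> V \<rbrakk> \<Longrightarrow> (\<lambda>i. a * u i + mat_apply n A v i) \<in> V"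
    "v \<in> V"
  shows "poly_apply n A p v \<in> V"
proof (induction p)
  case 0
  have "poly_apply n A 0 v = (\<lambda>_. 0)" by (simp add: fun_eq_iff)
  then show ?case using assms(1) by simp
next
  case (pCons a p)
  have "poly_apply n A (pCons a p) v = (\<lambda>i. a * v i + mat_apply n A (poly_apply n A p v) i)"
    by (simp add: fun_eq_iff poly_apply_pCons)
  then show ?case using assms(2)[OF assms(3) pCons.IH] by simp
qed

lemma char_poly_matrix_index:
  assumes "A \<in> carrier_mat n n" "i < n" "j < n"
  shows "char_poly_matrix A $$ (i, j) = (if i = j then [:0, 1:] else 0) - [:A $$ (i, j):]"
  using assms by (auto simp: char_poly_matrix_def)

text \<open>The product of \<open>x - A\<close> with its adjugate is the characteristic polynomial, and the columns of \<open>x - A\<close>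
  evaluate to \<open>0\<close> when the polynomials in row \<open>j\<close> act on the \<open>j\<close>-th unit vector.\<close>
lemma cayley_hamilton:
  assumes A: "A \<in> carrier_mat n n" and i: "i < n"
  shows "poly_apply n A (char_poly A) v i = 0"
proof -
  define e :: "nat \<Rightarrow> nat \<Rightarrow> 'a" where "e = (\<lambda>k i. if i = k then 1 else 0)"
  let ?C = "char_poly_matrix A"
  have C: "?C \<in> carrier_mat n n" using A by simp
  \<comment> \<open>Column \<open>k\<close> of \<open>x - A\<close> evaluates to
    \<open>A e_k\<close> minus column \<open>k\<close> of \<open>A\<close>.\<close>
  have column: "(\<Sum>j<n. poly_apply n A (?C $$ (j, k)) (e j) i) = 0" if ik: "i < n" "k < n" for i k
  proof -
    have "(\<Sum>j<n. poly_apply n A (?C $$ (j, k)) (e j) i) =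
        (\<Sum>j<n. (if j = k then mat_apply n A (e k) i else 0) - (if j = i then A $$ (i, k) else 0))"
      using ik by (intro sum.cong refl)
        (auto simp: char_poly_matrix_index[OF A] poly_apply_diff poly_apply_pCons mat_apply_def e_def)
    also have "\<dots> = mat_apply n A (e k) i - A $$ (i, k)"
      using ik by (simp add: sum_subtractf)
    also have "\<dots> = 0" using ik by (simp add: mat_apply_def e_def if_distrib cong: if_cong)
    finally show ?thesis .
  qed
  have unit: "poly_apply n A (char_poly A) (e m) i = 0" if m: "m < n" for m
  proof -
    have "(?C * adj_mat ?C) $$ (j, m) = (if j = m then char_poly A else 0)" if "j < n" for j
      unfolding adj_mat(2)[OF C] using that m by (simp add: char_poly_def)
    moreover have "(?C * adj_mat ?C) $$ (j, m) = (\<Sum>k<n. adj_mat ?C $$ (k, m) * ?C $$ (j, k))"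
      if "j < n" for j
      using that m C adj_mat(1)[OF C]
      by (auto simp: scalar_prod_def atLeast0LessThan mult.commute intro!: sum.cong)
    ultimately have "(\<Sum>k<n. adj_mat ?C $$ (k, m) * ?C $$ (j, k)) = (if j = m then char_poly A else 0)"
      if "j < n" for j
      using that by simp
    \<comment> \<open>Column \<open>m\<close> of the product is evaluated in two ways. On the
      diagonal it gives \<open>char_poly A\<close> acting on \<open>e m\<close>; after swapping the
      sums, the adjugate entries act on the vanishing columns.\<close>
    then have "poly_apply n A (char_poly A) (e m) i =
        (\<Sum>j<n. if j = m then poly_apply n A (\<Sum>k<n. adj_mat ?C $$ (k, m) * ?C $$ (j, k)) (e j) i else 0)"
      using m by simp
    also have "\<dots> = (\<Sum>j<n. poly_apply n A (\<Sum>k<n. adj_mat ?C $$ (k, m) * ?C $$ (j, k)) (e j) i)"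
      using \<open>\<And>j. j < n \<Longrightarrow> (\<Sum>k<n. adj_mat ?C $$ (k, m) * ?C $$ (j, k)) = (if j = m then char_poly A else 0)\<close>
      by (intro sum.cong) auto
    also have "\<dots> = (\<Sum>k<n. \<Sum>j<n. poly_apply n A (adj_mat ?C $$ (k, m)) (poly_apply n A (?C $$ (j, k)) (e j)) i)"
      unfolding poly_apply_sum poly_apply_mult by (rule sum.swap)
    also have "\<dots> = (\<Sum>k<n. poly_apply n A (adj_mat ?C $$ (k, m))
        (\<lambda>i. \<Sum>j<n. 1 * poly_apply n A (?C $$ (j, k)) (e j) i) i)"
      unfolding poly_apply_linear by simp
    also have "\<dots> = (\<Sum>k<n. poly_apply n A (adj_mat ?C $$ (k, m)) (\<lambda>i. 0) i)"
      using i column by (intro sum.cong poly_apply_cong) auto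
    also have "\<dots> = 0"
    proof -
      have "poly_apply n A p (\<lambda>i. 0) i = 0" for p
        using poly_apply_linear[of n A p "\<lambda>_. 0" "\<lambda>_ _. 0" "{}"] by simp
      then show ?thesis by simp
    qed
    finally show ?thesis .
  qed
  have "poly_apply n A (char_poly A) v i = poly_apply n A (char_poly A) (\<lambda>i. \<Sum>m<n. v m * e m i) i"
    by (rule poly_apply_cong) (auto simp: e_def i if_distrib cong: if_cong)
  also have "\<dots> = 0" unfolding poly_apply_linear by (simp add: unit)
  finally show ?thesis .
qed

text \<open>The vector \<open>w\<close> is \<open>((f(x) - f(A)) / (x - A)) v\<close>: an eigenvector of \<open>A\<close> for the eigenvalue \<open>x\<close>
  modulo any ideal containing \<open>f\<close> and \<open>f(A) v\<close>.\<close>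
lemma eigenvector_division:
  fixes A :: "'a::comm_ring_1 mat"
  shows "\<exists>w. (\<forall>i. [:0, 1:] * w i - (\<Sum>j<n. [:A $$ (i, j):] * w j) = smult (v i) f - [:poly_apply n A f v i:])
    \<and> (\<forall>m. \<exists>q. \<forall>i. coeff (w i) m = poly_apply n A q v i)
    \<and> (\<forall>i. \<forall>m\<ge>degree f. coeff (w i) m = 0)
    \<and> (degree f > 0 \<longrightarrow> (\<forall>i. coeff (w i) (degree f - 1) = lead_coeff f * v i))"
proof (induction f)
  case 0
  show ?case by (rule exI[of _ "\<lambda>_. 0"]) (auto intro!: exI[of _ 0])
next
  case (pCons a g)
  let ?u = "poly_apply n A g v"
  from pCons.IH obtain w where w: "\<forall>i. [:0, 1:] * w i - (\<Sum>j<n. [:A $$ (i, j):] * w j) = smult (v i) g - [:?u i:]"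
    "\<forall>m. \<exists>q. \<forall>i. coeff (w i) m = poly_apply n A q v i"
    "\<forall>i. \<forall>m\<ge>degree g. coeff (w i) m = 0"
    "degree g > 0 \<longrightarrow> (\<forall>i. coeff (w i) (degree g - 1) = lead_coeff g * v i)"
    by (elim exE conjE)
  \<comment> \<open>Write \<open>u\<close> for \<open>?u\<close>. For \<open>f = a + x g\<close>,
    \<open>(x - A) (u + x w) = x g v - A u\<close>, which equals \<open>f v - f(A) v\<close> because
    \<open>f(A) v = a v + A u\<close>.\<close>
  let ?w = "\<lambda>i. pCons (?u i) (w i)"
  have "[:0, 1:] * ?w i - (\<Sum>j<n. [:A $$ (i, j):] * ?w j) =
      smult (v i) (pCons a g) - [:poly_apply n A (pCons a g) v i:]" for i
  proof -
    have "(\<Sum>j<n. [:A $$ (i, j):] * ?w j) =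
        (\<Sum>j<n. [:A $$ (i, j) * ?u j:] + pCons 0 ([:A $$ (i, j):] * w j))"
      by (intro sum.cong) auto
    also have "\<dots> = [:mat_apply n A ?u i:] + pCons 0 (\<Sum>j<n. [:A $$ (i, j):] * w j)"
    proof -
      have "sum (\<lambda>j. [:c j:]) S = [:sum c S:]" "sum (\<lambda>j. pCons 0 (p j)) S = pCons 0 (sum p S)"
        for c :: "nat \<Rightarrow> 'a" and p :: "nat \<Rightarrow> 'a poly" and S
        by (induction S rule: infinite_finite_induct) auto
      then show ?thesis by (simp only: sum.distrib mat_apply_def)
    qed
    finally have "[:0, 1:] * ?w i - (\<Sum>j<n. [:A $$ (i, j):] * ?w j) =
        pCons 0 ([:?u i:] + ([:0, 1:] * w i - (\<Sum>j<n. [:A $$ (i, j):] * w j))) - [:mat_apply n A ?u i:]"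
      by simp
    also have "\<dots> = pCons 0 (smult (v i) g) - [:mat_apply n A ?u i:]"
      by (simp only: w(1)[rule_format]) simp
    also have "\<dots> = smult (v i) (pCons a g) - [:poly_apply n A (pCons a g) v i:]"
      by (simp add: poly_apply_pCons mult.commute)
    finally show ?thesis .
  qed
  moreover have "\<exists>q. \<forall>i. coeff (?w i) m = poly_apply n A q v i" for m
    using w(2)[rule_format, of "m - 1"] by (cases m) auto
  moreover have "coeff (?w i) m = 0" if "m \<ge> degree (pCons a g)" for i m
  proof (cases "g = 0")
    case True
    then show ?thesis using w(3) by (cases m) auto
  next
    case False
    then show ?thesis using that w(3) by (cases m) auto
  qed
  moreover have "coeff (?w i) (degree (pCons a g) - 1) = lead_coeff (pCons a g) * v i"
    if "degree (pCons a g) > 0" for i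
  proof -
    from that have g: "g \<noteq> 0" by auto
    show ?thesis
    proof (cases "degree g")
      case 0
      \<comment> \<open>For constant \<open>g\<close> the induction hypothesis on top coefficients
        is void; here \<open>?u\<close> itself, equal to \<open>c v\<close>, is the top
        coefficient.\<close>
      then obtain c where c: "g = [:c:]" by (rule degree_eq_zeroE)
      show ?thesis using g by (simp add: c poly_apply_pCons mat_apply_def)
    next
      case (Suc d)
      then show ?thesis using g w(4) by simp
    qed
  qed
  ultimately show ?case by (intro exI[of _ ?w]) blast
qed

section \<open>Isotropic invariant submodules\<close>

text \<open>Among the pairs \<open>(f, v)\<close> with \<open>f(A) v = 0\<close> modulo \<open>P\<close>, where neither \<open>f\<close> nor \<open>v\<close> vanishes modulo \<open>P\<close>,
  take one with \<open>f\<close> of least degree. By minimality the annihilator \<open>I\<close> of \<open>v\<close> modulo \<open>P\<close> is a prime ideal of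
  the polynomial ring, and \<open>w = ((f(x) - f(A)) / (x - A)) v\<close> is an isotropic eigenvector of \<open>A\<close> modulo \<open>I\<close>.\<close>
lemma isotropic_submodule_kernel:
  fixes A :: "'a::idom mat"
  assumes P: "primeideal P type_ring" and A: "A \<in> carrier_mat n n" "transpose_mat A = A"
    and V: "(\<lambda>_. 0) \<in> V" "\<And>u v a. \<lbrakk> u \<in> V; v \<in> V \<rbrakk> \<Longrightarrow> (\<lambda>i. a * u i + mat_apply n A v i) \<in> V"
    and iso: "\<And>u v. \<lbrakk> u \<in> V; v \<in> V \<rbrakk> \<Longrightarrow> (\<Sum>i<n. u i * v i) \<in> P"
    and v0: "v0 \<in> V" "i0 < n" "v0 i0 \<notin> P"
  shows "\<exists>v\<in>V. (\<exists>i<n. v i \<notin> P) \<and> (\<forall>i<n. poly_apply n A (pderiv (char_poly A)) v i \<in> P)"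
proof -
  note idP = primeideal_ideal[OF P]
  have V_poly: "poly_apply n A p v \<in> V" if "v \<in> V" for p v
    by (rule poly_apply_closed) (fact V that)+
  define good where "good = (\<lambda>(f, v). v \<in> V \<and> (\<exists>i<n. v i \<notin> P) \<and> (\<exists>k. coeff f k \<notin> P) \<and>
    (\<forall>i<n. poly_apply n A f v i \<in> P))"
  \<comment> \<open>A pair exists: \<open>char_poly A\<close> is monic, so nonzero modulo
    \<open>P\<close>, and it annihilates \<open>v0\<close> by Cayley-Hamilton.\<close>
  have "lead_coeff (char_poly A) = 1" using degree_monic_char_poly[OF A(1)] by simp
  then have "coeff (char_poly A) (degree (char_poly A)) \<notin> P"
    using P by (simp add: primeideal_type_ring_iff)
  then have "good (char_poly A, v0)"
    using v0 cayley_hamilton[OF A(1)] ideal_zero[OF idP] by (auto simp: good_def)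
  then obtain fv where "good fv" "\<And>gu. good gu \<Longrightarrow> degree (fst fv) \<le> degree (fst gu)"
    using ex_has_least_nat[of good _ "\<lambda>fv. degree (fst fv)"] by blast
  then obtain f v where good: "good (f, v)" and least: "\<And>g u. good (g, u) \<Longrightarrow> degree f \<le> degree g"
    by (cases fv) force
  have v: "v \<in> V" "\<exists>i<n. v i \<notin> P" and f: "\<exists>k. coeff f k \<notin> P"
    and fv: "\<And>i. i < n \<Longrightarrow> poly_apply n A f v i \<in> P"
    using good by (auto simp: good_def)
  \<comment> \<open>Minimality in the form used for remainders; the alternative \<open>g = 0\<close>
    matches the output of \<open>pseudo_divmod\<close>.\<close>
  have least': "coeff g k \<in> P"
    if "u \<in> V" "\<exists>i<n. u i \<notin> P" "\<And>i. i < n \<Longrightarrow> poly_apply n A g u i \<in> P" "g = 0 \<or> degree g < degree f"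
    for g u k
  proof (rule ccontr)
    assume "coeff g k \<notin> P"
    then have "good (g, u)" "g \<noteq> 0" using that ideal_zero[OF idP] by (auto simp: good_def)
    then show False using least[of g u] that(4) by simp
  qed
  have degree_f: "degree f > 0"
  proof (rule ccontr)
    assume "\<not> degree f > 0"
    then obtain c where c: "f = [:c:]" by (auto elim: degree_eq_zeroE)
    obtain k where "coeff f k \<notin> P" using f by blast
    then have "c \<notin> P" by (cases k) (auto simp: c ideal_zero[OF idP])
    moreover have "c * v i \<in> P" if "i < n" for i
      using fv[OF that] by (simp add: c poly_apply_pCons mat_apply_def)
    ultimately show False using v(2) by (auto simp: primeideal_mult_iff[OF P])
  qed
  \<comment> \<open>Otherwise removing the leading term would lower the degree without changing
    \<open>f\<close> modulo \<open>P\<close>.\<close>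
  have lead_f: "lead_coeff f \<notin> P"
  proof
    assume lead: "lead_coeff f \<in> P"
    define h where "h = monom (lead_coeff f) (degree f)"
    have h: "coeff h k \<in> P" for k using lead ideal_zero[OF idP] by (auto simp: h_def)
    have "degree (f - h) < degree f"
      using degree_f by (intro degree_lessI) (auto simp: h_def coeff_eq_0)
    moreover have "poly_apply n A (f - h) v i \<in> P" if "i < n" for i
      unfolding poly_apply_diff
      by (intro ideal_diff[OF idP] fv that poly_apply_mem_ideal_coeff[OF idP] h)
    ultimately have "coeff (f - h) k \<in> P" for k using least'[OF v] by blast
    then have "coeff (f - h) k + coeff h k \<in> P" for k using h ideal_add[OF idP] by blast
    then show False using f by simp
  qed
  define I where "I = {h. \<forall>i<n. poly_apply n A h v i \<in> P}"
  have I: "primeideal I type_ring"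
    unfolding primeideal_type_ring_iff
  proof (intro conjI allI impI)
    show "ideal I type_ring"
      unfolding ideal_type_ring_iff I_def
      by (auto simp: poly_apply_add poly_apply_mult ideal_zero[OF idP]
          intro: ideal_add[OF idP] poly_apply_mem_ideal[OF idP])
    have "poly_apply n A 1 v = v"
      by (simp add: fun_eq_iff poly_apply_pCons one_pCons mat_apply_def)
    then show "1 \<notin> I" using v(2) by (auto simp: I_def)
    fix h1 h2 assume h12: "h1 * h2 \<in> I"
    show "h1 \<in> I \<or> h2 \<in> I"
    proof (rule disjCI)
      assume "h2 \<notin> I"
      \<comment> \<open>With \<open>h2\<close> outside \<open>I\<close>, the vector \<open>u\<close>
        is again nonzero modulo \<open>P\<close>, so minimality of \<open>f\<close> applies to
        \<open>u\<close> as well as to \<open>v\<close>.\<close>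
      define u where "u = poly_apply n A h2 v"
      have u: "u \<in> V" "\<exists>i<n. u i \<notin> P"
        using \<open>h2 \<notin> I\<close> v(1) by (auto simp: u_def I_def intro: V_poly)
      have "f \<noteq> 0" using degree_f by auto
      \<comment> \<open>Pseudo-division replaces division by \<open>f\<close>; the extra power of
        the leading coefficient is outside \<open>P\<close> and can be cancelled. The remainder
        annihilates \<open>u\<close> modulo \<open>P\<close>, so its coefficients lie in
        \<open>P\<close>.\<close>
      obtain q r where "pseudo_divmod h1 f = (q, r)" by (cases "pseudo_divmod h1 f") auto
      from pseudo_divmod[OF \<open>f \<noteq> 0\<close> this] obtain k where
        div: "smult (lead_coeff f ^ k) h1 = f * q + r" and r: "r = 0 \<or> degree r < degree f" by auto
      have "poly_apply n A f w i \<in> P" if "w = u \<or> w = v" "i < n" for w i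
      proof -
        have "poly_apply n A f u = poly_apply n A h2 (poly_apply n A f v)"
          unfolding u_def by (simp add: mult.commute flip: poly_apply_mult)
        then show ?thesis
          using that fv poly_apply_mem_ideal[OF idP fv] by auto
      qed
      then have fq: "poly_apply n A (f * q) w i \<in> P" if "w = u \<or> w = v" "i < n" for w i
        using that poly_apply_mem_ideal[OF idP] by (simp add: poly_apply_mult mult.commute[of f])
      have "poly_apply n A r u i \<in> P" if "i < n" for i
      proof -
        have "poly_apply n A h1 u i \<in> P"
          using h12 that by (simp add: I_def u_def poly_apply_mult)
        then have "poly_apply n A (f * q + r) u i \<in> P"
          unfolding div[symmetric] poly_apply_smult by (rule ideal_mult_left[OF idP])
        then show ?thesis
          using ideal_add_cancel[OF idP fq[of u i]] that by (simp add: poly_apply_add)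
      qed
      then have "coeff r k \<in> P" for k using least'[OF u _ r] by blast
      then have r: "poly_apply n A r v i \<in> P" for i by (rule poly_apply_mem_ideal_coeff[OF idP])
      have "poly_apply n A h1 v i \<in> P" if "i < n" for i
      proof -
        have "poly_apply n A (f * q + r) v i \<in> P"
          unfolding poly_apply_add using fq[of v i] that r by (intro ideal_add[OF idP]) auto
        then have "lead_coeff f ^ k * poly_apply n A h1 v i \<in> P"
          by (simp add: div[symmetric] poly_apply_smult)
        then show ?thesis
          using primeideal_power_notin[OF P lead_f] by (simp add: primeideal_mult_iff[OF P])
      qed
      then show "h1 \<in> I" by (simp add: I_def)
    qed
  qed
  note idI = primeideal_ideal[OF I]
  have coeff_I: "h \<in> I" if "\<And>k. coeff h k \<in> P" for h
    using poly_apply_mem_ideal_coeff[OF idP that] by (simp add: I_def)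
  obtain w where w: "\<forall>i. [:0, 1:] * w i - (\<Sum>j<n. [:A $$ (i, j):] * w j) =
      smult (v i) f - [:poly_apply n A f v i:]"
    "\<forall>m. \<exists>q. \<forall>i. coeff (w i) m = poly_apply n A q v i"
    "\<forall>i. \<forall>m\<ge>degree f. coeff (w i) m = 0"
    "\<forall>i. coeff (w i) (degree f - 1) = lead_coeff f * v i"
    using eigenvector_division[of A n v f] degree_f by blast
  have w_V: "(\<lambda>i. coeff (w i) m) \<in> V" for m
  proof -
    obtain q where "\<And>i. coeff (w i) m = poly_apply n A q v i" using w(2) by blast
    then have "(\<lambda>i. coeff (w i) m) = poly_apply n A q v" by auto
    then show ?thesis using V_poly[OF v(1)] by simp
  qed
  let ?C = "char_poly_matrix A"
  obtain m where m: "m < n" "v m \<notin> P" using v(2) by blast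
  have "(\<Sum>k<n. cofactor ?C k k) \<in> I"
  proof (rule trace_adjugate_mem_primeideal[OF I])
    show "?C \<in> carrier_mat n n" using A(1) by simp
    have "A $$ (i, j) = A $$ (j, i)" if "i < n" "j < n" for i j
      using A that by (metis carrier_matD index_transpose_mat(1))
    then show "transpose_mat ?C = ?C"
      using A(1) by (intro eq_matI) (auto simp: char_poly_matrix_def)
    show "(\<Sum>j<n. ?C $$ (i, j) * w j) \<in> I" if i: "i < n" for i
    proof -
      have "(\<Sum>j<n. ?C $$ (i, j) * w j) =
          (\<Sum>j<n. (if j = i then [:0, 1:] * w j else 0) - [:A $$ (i, j):] * w j)"
        using i by (intro sum.cong refl) (auto simp: char_poly_matrix_index[OF A(1)] left_diff_distrib)
      also have "\<dots> = smult (v i) f - [:poly_apply n A f v i:]"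
        unfolding w(1)[rule_format, symmetric] using i by (simp add: sum_subtractf)
      also have "\<dots> \<in> I"
      proof (rule ideal_diff[OF idI])
        have "f \<in> I" using fv by (simp add: I_def)
        then show "smult (v i) f \<in> I" using ideal_mult_left[OF idI, of f "[:v i:]"] by simp
        show "[:poly_apply n A f v i:] \<in> I"
          using fv[OF i] ideal_zero[OF idP] by (intro coeff_I) (simp add: coeff_pCons split: nat.splits)
      qed
      finally show ?thesis .
    qed
    show "(\<Sum>i<n. w i * w i) \<in> I"
    proof (rule coeff_I)
      fix k
      \<comment> \<open>Each coefficient of the square sum is a sum of pairings of coefficient
        vectors of \<open>w\<close>, all of which lie in \<open>V\<close>.\<close>
      have "coeff (\<Sum>i<n. w i * w i) k = (\<Sum>a\<le>k. \<Sum>i<n. coeff (w i) a * coeff (w i) (k - a))"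
        unfolding coeff_sum coeff_mult by (rule sum.swap)
      also have "\<dots> \<in> P" by (intro ideal_sum[OF idP] iso[OF w_V w_V])
      finally show "coeff (\<Sum>i<n. w i * w i) k \<in> P" .
    qed
    show "m < n" by (rule m)
    show "w m \<notin> I"
    proof
      \<comment> \<open>The degree of \<open>w m\<close> is below that of \<open>f\<close>, yet its
        coefficient \<open>lead_coeff f * v m\<close> is outside \<open>P\<close>.\<close>
      assume "w m \<in> I"
      moreover have "degree (w m) < degree f"
        using w(3) degree_f by (intro degree_lessI) auto
      ultimately have "coeff (w m) (degree f - 1) \<in> P"
        using least'[OF v, of "w m"] by (simp add: I_def)
      then show False using w(4) m lead_f by (simp add: primeideal_mult_iff[OF P])
    qed
  qed
  then show ?thesis
    using v by (auto simp: I_def pderiv_char_poly_cofactor[OF A(1)] intro!: bexI[of _ v])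
qed

section \<open>Matrices \<open>poly_mat\<close>, clearing denominators and the conclusion\<close>

lemma pow_mat_apply:
  assumes A: "A \<in> carrier_mat n n" and i: "i < n"
  shows "(\<Sum>j<n. (A ^\<^sub>m k) $$ (i, j) * v j) = (mat_apply n A ^^ k) v i"
proof (induction k arbitrary: v)
  case 0
  have "(\<Sum>j<n. (A ^\<^sub>m 0) $$ (i, j) * v j) = (\<Sum>j<n. if j = i then v j else 0)"
    using A i by (intro sum.cong) auto
  then show ?case using i by simp
next
  case (Suc k)
  have "(\<Sum>j<n. (A ^\<^sub>m Suc k) $$ (i, j) * v j) = (\<Sum>j<n. (\<Sum>l<n. (A ^\<^sub>m k) $$ (i, l) * A $$ (l, j)) * v j)"
    using A i pow_carrier_mat[OF A, of k]
    by (intro sum.cong refl) (auto simp: scalar_prod_def atLeast0LessThan intro!: sum.cong)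
  also have "\<dots> = (\<Sum>l<n. (A ^\<^sub>m k) $$ (i, l) * mat_apply n A v l)"
    unfolding mat_apply_def sum_distrib_left sum_distrib_right
    by (subst sum.swap) (simp add: mult.assoc)
  also have "\<dots> = (mat_apply n A ^^ Suc k) v i"
    unfolding Suc.IH by (simp only: funpow_Suc_right o_apply)
  finally show ?case .
qed

lemma poly_mat_apply:
  assumes A: "A \<in> carrier_mat n n" and i: "i < n"
  shows "(\<Sum>j<n. poly_mat p A $$ (i, j) * v j) = poly_apply n A p v i"
proof -
  have "(\<Sum>j<n. poly_mat p A $$ (i, j) * v j) =
      (\<Sum>j<n. \<Sum>k\<le>degree p. coeff p k * ((A ^\<^sub>m k) $$ (i, j) * v j))"
    using A i by (intro sum.cong refl) (auto simp: poly_mat_def sum_distrib_right mult.assoc)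
  also have "\<dots> = (\<Sum>k\<le>degree p. coeff p k * (\<Sum>j<n. (A ^\<^sub>m k) $$ (i, j) * v j))"
    unfolding sum_distrib_left by (rule sum.swap)
  also have "\<dots> = poly_apply n A p v i"
    by (simp add: pow_mat_apply[OF A i] poly_apply_def)
  finally show ?thesis .
qed

text \<open>Powers of \<open>A\<close> commute with \<open>A\<close>, so they inherit its symmetry.
  This makes \<open>square_times_det_mem\<close> applicable to the matrix in the
  discriminant.\<close>

lemma transpose_poly_mat:
  fixes A :: "'a::comm_ring_1 mat"
  assumes A: "A \<in> carrier_mat n n" "transpose_mat A = A"
  shows "transpose_mat (poly_mat p A) = poly_mat p A"
proof -
  have comm: "A * A ^\<^sub>m k = A ^\<^sub>m k * A" for k
  proof (induction k)
    case (Suc k)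
    have "A * A ^\<^sub>m Suc k = (A * A ^\<^sub>m k) * A"
      using A(1) pow_carrier_mat[OF A(1), of k] by (simp add: assoc_mult_mat[of _ n n _ n _ n])
    then show ?case using Suc by simp
  qed (use A(1) in simp)
  have pow: "transpose_mat (A ^\<^sub>m k) = A ^\<^sub>m k" for k
  proof (induction k)
    case (Suc k)
    then show ?case
      using A comm[of k] by (simp add: transpose_mult[OF pow_carrier_mat[OF A(1)] A(1)])
  qed (use A(1) in simp)
  have "(A ^\<^sub>m k) $$ (i, j) = (A ^\<^sub>m k) $$ (j, i)" if "i < n" "j < n" for i j k
    using pow[of k] pow_carrier_mat[OF A(1), of k] that
    by (metis carrier_matD index_transpose_mat(1))
  then show ?thesis
    using A(1) by (intro eq_matI) (auto simp: poly_mat_def)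
qed

text \<open>The product of one denominator for each value among the entries clears them all. The
  level is therefore a nonzero ideal, as cancellation requires.\<close>

lemma common_denominator:
  fixes Q :: "'a::idom fract mat"
  assumes "Q \<in> carrier_mat n n"
  shows "\<exists>d\<in>level n Q. d \<noteq> 0"
proof -
  have "\<exists>b. b \<noteq> 0 \<and> (\<exists>a. to_fract b * x = to_fract a)" for x :: "'a fract"
  proof (cases x rule: Fract_cases)
    case (Fract a b)
    then show ?thesis by (intro exI[of _ b]) (auto simp: Fract_conv_to_fract)
  qed
  then obtain b where b: "\<And>x. b x \<noteq> 0" "\<And>x :: 'a fract. \<exists>a. to_fract (b x) * x = to_fract a"
    by metis
  define S where "S = (\<lambda>ij. Q $$ ij) ` ({..<n} \<times> {..<n})"
  have S: "finite S" by (simp add: S_def)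
  have "(\<Prod>x\<in>S. b x) \<in> level n Q"
    unfolding level_def integral_mats_iff mem_Collect_eq
  proof (intro conjI allI impI)
    fix i j assume ij: "i < n" "j < n"
    let ?x = "Q $$ (i, j)"
    have x: "?x \<in> S" using ij by (auto simp: S_def)
    obtain a where a: "to_fract (b ?x) * ?x = to_fract a" using b(2) by blast
    have "to_fract (\<Prod>x\<in>S. b x) * ?x = to_fract (\<Prod>x\<in>S - {?x}. b x) * (to_fract (b ?x) * ?x)"
      by (simp add: prod.remove[OF S x] mult.commute mult.left_commute)
    also have "\<dots> = to_fract ((\<Prod>x\<in>S - {?x}. b x) * a)" by (simp add: a)
    finally have "(to_fract (\<Prod>x\<in>S. b x) \<cdot>\<^sub>m Q) $$ (i, j) = to_fract ((\<Prod>x\<in>S - {?x}. b x) * a)"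
      using assms ij by simp
    then show "(to_fract (\<Prod>x\<in>S. b x) \<cdot>\<^sub>m Q) $$ (i, j) \<in> range to_fract"
      by (simp only: rangeI)
  qed (use assms in simp)
  moreover have "(\<Prod>x\<in>S. b x) \<noteq> 0" using S b(1) by simp
  ultimately show ?thesis by blast
qed

text \<open>Pick \<open>\<alpha> \<in> C - P C\<close>. If \<open>\<alpha> p Q\<close> had entries in \<open>P\<close> for every \<open>p \<in> P\<close>, then an entry \<open>a / b\<close> of \<open>\<alpha> Q\<close>
  would satisfy \<open>(a, b) P = (b) P\<close>, hence lie in the ring, so that \<open>\<alpha>\<close> would belong to the level.\<close>
lemma primitive_multiple:
  fixes Q :: "'a::idom fract mat"
  assumes ded: "dedekind_domain (type_ring :: 'a ring)" and P: "primeideal P type_ring" "P \<noteq> {0}"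
    and Q: "Q \<in> carrier_mat n n" and C: "ideal C type_ring" "level n Q = P \<cdot>\<^bsub>type_ring\<^esub> C"
  shows "\<exists>r\<in>P. \<exists>Q'\<in>carrier_mat n n. map_mat to_fract Q' = to_fract r \<cdot>\<^sub>m Q \<and>
    (\<exists>i<n. \<exists>j<n. Q' $$ (i, j) \<notin> P)"
proof -
  interpret cring "type_ring :: 'a ring" by (rule cring_from_type_algebra)
  note idP = primeideal_ideal[OF P(1)]
  have UN: "ideal UNIV (type_ring :: 'a ring)" by (simp add: ideal_type_ring_iff)
  have PC: "ideal (P \<cdot>\<^bsub>type_ring\<^esub> C) type_ring" by (intro ideal_prod_type_ring_ideal idP C(1))
  obtain q where q: "q \<in> P" "q \<noteq> 0" using P(2) ideal_zero[OF idP] by blast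
  obtain d where d: "d \<in> level n Q" "d \<noteq> 0" using common_denominator[OF Q] by blast
  have sub: "level n Q \<subseteq> C" using ideal_prod_inter[OF idP C(1)] C(2) by blast
  have "C \<noteq> level n Q"
  proof
    assume "C = level n Q"
    then have "C \<cdot>\<^bsub>type_ring\<^esub> P = C \<cdot>\<^bsub>type_ring\<^esub> UNIV"
      using C(2) ideal_prod_commute[OF idP C(1)] ideal_prod_one[OF C(1)] by simp
    then have "P = UNIV"
      using type_ring_ideal_prod_cancel[OF ded C(1) _ d(2) idP q UN UNIV_I one_neq_zero] sub d(1) by blast
    then show False using P(1) by (simp add: primeideal_type_ring_iff)
  qed
  then obtain \<alpha> where \<alpha>: "\<alpha> \<in> C" "\<alpha> \<notin> level n Q" using sub by blast
  have "\<alpha> * p \<in> level n Q" if "p \<in> P" for p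
    unfolding C(2) using ideal_prod_mem[OF that \<alpha>(1), of] by (simp add: mult.commute)
  then have "\<exists>R. R \<in> carrier_mat n n \<and> map_mat to_fract R = to_fract (\<alpha> * p) \<cdot>\<^sub>m Q" if "p \<in> P" for p
    using that by (force simp: level_def integral_mats_def)
  then obtain M where M: "\<And>p. p \<in> P \<Longrightarrow> M p \<in> carrier_mat n n"
    "\<And>p. p \<in> P \<Longrightarrow> map_mat to_fract (M p) = to_fract (\<alpha> * p) \<cdot>\<^sub>m Q"
    by metis
  have M_index: "to_fract (M p $$ (i, j)) = to_fract p * (to_fract \<alpha> * Q $$ (i, j))"
    if "p \<in> P" "i < n" "j < n" for p i j
  proof -
    have "to_fract (M p $$ (i, j)) = map_mat to_fract (M p) $$ (i, j)"
      using M(1)[OF that(1)] that by simp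
    also have "\<dots> = (to_fract (\<alpha> * p) \<cdot>\<^sub>m Q) $$ (i, j)" by (simp only: M(2)[OF that(1)])
    also have "\<dots> = to_fract p * (to_fract \<alpha> * Q $$ (i, j))"
      using Q that by (simp add: mult.commute mult.left_commute)
    finally show ?thesis .
  qed
  have "\<exists>p\<in>P. \<exists>i<n. \<exists>j<n. M p $$ (i, j) \<notin> P"
  proof (rule ccontr)
    assume neg: "\<not> (\<exists>p\<in>P. \<exists>i<n. \<exists>j<n. M p $$ (i, j) \<notin> P)"
    have "to_fract \<alpha> * Q $$ (i, j) \<in> range to_fract" if ij: "i < n" "j < n" for i j
    proof (cases "to_fract \<alpha> * Q $$ (i, j)" rule: Fract_cases)
      case (Fract a b)
      \<comment> \<open>The entry of \<open>M p\<close> is \<open>p\<close> times the fraction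
        \<open>a / b\<close>; by \<open>neg\<close> it lies in \<open>P\<close>, so
        \<open>a p\<close> lies in \<open>b P\<close>.\<close>
      have ab: "a * p = b * M p $$ (i, j)" if "p \<in> P" for p
      proof -
        have "to_fract (b * M p $$ (i, j)) = to_fract (a * p)"
          using M_index[OF that ij] Fract by (simp add: Fract_conv_to_fract)
        then show ?thesis by (simp only: to_fract_eq_iff)
      qed
      let ?J = "ideal2 a b" and ?b = "ideal2 b 0"
      have "?J \<cdot>\<^bsub>type_ring\<^esub> P = ?b \<cdot>\<^bsub>type_ring\<^esub> P"
      proof
        show "?J \<cdot>\<^bsub>type_ring\<^esub> P \<subseteq> ?b \<cdot>\<^bsub>type_ring\<^esub> P"
        proof (intro ideal2_prod_subset ideal_prod_type_ring_ideal ideal2_ideal idP)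
          fix p assume p: "p \<in> P"
          show "b * p \<in> ?b \<cdot>\<^bsub>type_ring\<^esub> P" using p by (intro ideal_prod_mem ideal2_gens)
          have "M p $$ (i, j) \<in> P" using neg p ij by blast
          then show "a * p \<in> ?b \<cdot>\<^bsub>type_ring\<^esub> P"
            unfolding ab[OF p] by (intro ideal_prod_mem ideal2_gens)
        qed
        have "?b \<subseteq> ?J" by (intro ideal2_subset ideal2_ideal ideal2_gens ideal_zero)
        then show "?b \<cdot>\<^bsub>type_ring\<^esub> P \<subseteq> ?J \<cdot>\<^bsub>type_ring\<^esub> P"
          by (intro ideal_prod_type_ring_subset ideal_prod_type_ring_ideal ideal2_ideal idP)
            (auto intro: ideal_prod_mem)
      qed
      then have "P \<cdot>\<^bsub>type_ring\<^esub> ?J = P \<cdot>\<^bsub>type_ring\<^esub> ?b"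
        by (simp add: ideal_prod_commute idP ideal2_ideal)
      then have "?J = ?b"
        using type_ring_ideal_prod_cancel[OF ded idP q ideal2_ideal ideal2_gens(2) _ ideal2_ideal ideal2_gens(1)] Fract(2)
        by blast
      then have "b dvd a" using ideal2_gens(1)[of a b] by (simp only: ideal2_zero_iff)
      then show ?thesis using Fract by (auto simp: Fract_conv_to_fract dvd_def)
    qed
    then have "\<alpha> \<in> level n Q" using Q by (simp add: level_def integral_mats_iff)
    then show False using \<alpha>(2) by contradiction
  qed
  then obtain p i j where p: "p \<in> P" "i < n" "j < n" "M p $$ (i, j) \<notin> P" by blast
  \<comment> \<open>The scaling factor is \<open>\<alpha> * p\<close>, which lies in
    \<open>P\<close> because \<open>p\<close> does.\<close>
  show ?thesis
    using p M[OF p(1)] ideal_mult_left[OF idP p(1), of \<alpha>] by blast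
qed

text \<open>The relation \<open>A * M = M * B\<close> makes the column module of \<open>M\<close>
  stable under \<open>A\<close>, and the Gram condition makes it isotropic modulo
  \<open>P^2\<close>. Isotropy modulo \<open>P\<close> suffices to find \<open>v\<close>; the full
  strength serves for the diagonal entry.\<close>

lemma discriminant_mem_square:
  fixes A B M :: "'a::idom mat"
  assumes ded: "dedekind_domain (type_ring :: 'a ring)" and P: "primeideal P type_ring" "P \<noteq> {0}"
    and A: "A \<in> carrier_mat n n" "transpose_mat A = A" and B: "B \<in> carrier_mat n n"
    and M: "M \<in> carrier_mat n n" "A * M = M * B"
    and gram: "\<And>i j. \<lbrakk> i < n; j < n \<rbrakk> \<Longrightarrow> (transpose_mat M * M) $$ (i, j) \<in> P \<cdot>\<^bsub>type_ring\<^esub> P"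
    and entry: "i0 < n" "j0 < n" "M $$ (i0, j0) \<notin> P"
  shows "discriminant A \<in> P \<cdot>\<^bsub>type_ring\<^esub> P"
proof -
  interpret ring "type_ring :: 'a ring" by (rule ring_from_type_algebra)
  note idP = primeideal_ideal[OF P(1)]
  let ?PP = "P \<cdot>\<^bsub>type_ring\<^esub> P"
  have PP: "ideal ?PP type_ring" by (intro ideal_prod_type_ring_ideal idP)
  have PP_P: "?PP \<subseteq> P" using ideal_prod_inter[OF idP idP] by blast
  define V where "V = {v. \<exists>u. \<forall>i<n. v i = (\<Sum>j<n. M $$ (i, j) * u j)}"
  have V0: "(\<lambda>_. 0) \<in> V" by (auto simp: V_def intro!: exI[of _ "\<lambda>_. 0"])
  have V_closed: "(\<lambda>i. a * v i + mat_apply n A v' i) \<in> V" if vv': "v \<in> V" "v' \<in> V" for a v v'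
  proof -
    obtain u u' where "\<forall>i<n. v i = (\<Sum>j<n. M $$ (i, j) * u j)"
      and "\<forall>i<n. v' i = (\<Sum>j<n. M $$ (i, j) * u' j)"
      using vv' unfolding V_def by blast
    then have u: "\<And>i. i < n \<Longrightarrow> v i = (\<Sum>j<n. M $$ (i, j) * u j)"
      and u': "\<And>i. i < n \<Longrightarrow> v' i = (\<Sum>j<n. M $$ (i, j) * u' j)" by blast+
    have "a * v i + mat_apply n A v' i = (\<Sum>j<n. M $$ (i, j) * (a * u j + mat_apply n B u' j))"
      if i: "i < n" for i
    proof -
      have "mat_apply n A v' i = (\<Sum>k<n. A $$ (i, k) * (\<Sum>j<n. M $$ (k, j) * u' j))"
        unfolding mat_apply_def using u' by (intro sum.cong) auto
      also have "\<dots> = (\<Sum>j<n. (\<Sum>k<n. A $$ (i, k) * M $$ (k, j)) * u' j)"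
        unfolding sum_distrib_left sum_distrib_right by (subst sum.swap) (simp add: mult.assoc)
      also have "\<dots> = (\<Sum>j<n. (A * M) $$ (i, j) * u' j)"
        using A(1) M(1) i by (intro sum.cong refl) (auto simp: scalar_prod_def atLeast0LessThan intro!: sum.cong)
      also have "\<dots> = (\<Sum>j<n. (\<Sum>k<n. M $$ (i, k) * B $$ (k, j)) * u' j)"
        unfolding M(2) using B M(1) i
        by (intro sum.cong refl) (auto simp: scalar_prod_def atLeast0LessThan intro!: sum.cong)
      also have "\<dots> = (\<Sum>k<n. M $$ (i, k) * mat_apply n B u' k)"
        unfolding mat_apply_def sum_distrib_left sum_distrib_right
        by (subst sum.swap) (simp add: mult.assoc)
      finally show ?thesis
        by (simp add: u[OF i] distrib_left sum.distrib sum_distrib_left mult.left_commute)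
    qed
    then show ?thesis
      unfolding V_def mem_Collect_eq
      by (intro exI[of _ "\<lambda>j. a * u j + mat_apply n B u' j"] allI impI)
  qed
  have iso: "(\<Sum>i<n. v i * v' i) \<in> ?PP" if vv': "v \<in> V" "v' \<in> V" for v v'
  proof -
    obtain u u' where "\<forall>i<n. v i = (\<Sum>j<n. M $$ (i, j) * u j)"
      and "\<forall>i<n. v' i = (\<Sum>j<n. M $$ (i, j) * u' j)"
      using vv' unfolding V_def by blast
    then have u: "\<And>i. i < n \<Longrightarrow> v i = (\<Sum>j<n. M $$ (i, j) * u j)"
      and u': "\<And>i. i < n \<Longrightarrow> v' i = (\<Sum>j<n. M $$ (i, j) * u' j)" by blast+
    have "(\<Sum>i<n. v i * v' i) = (\<Sum>i<n. (\<Sum>j<n. M $$ (i, j) * u j) * (\<Sum>k<n. M $$ (i, k) * u' k))"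
      using u u' by (intro sum.cong) auto
    also have "\<dots> = (\<Sum>i<n. \<Sum>j<n. \<Sum>k<n. u j * u' k * (M $$ (i, j) * M $$ (i, k)))"
      unfolding sum_product by (intro sum.cong refl) (simp add: mult.commute mult.left_commute)
    also have "\<dots> = (\<Sum>j<n. \<Sum>k<n. \<Sum>i<n. u j * u' k * (M $$ (i, j) * M $$ (i, k)))"
      by (subst sum.swap) (intro sum.cong refl sum.swap)
    also have "\<dots> = (\<Sum>j<n. \<Sum>k<n. u j * u' k * (transpose_mat M * M) $$ (j, k))"
      using M(1) by (intro sum.cong refl)
        (auto simp: scalar_prod_def atLeast0LessThan sum_distrib_left intro!: sum.cong)
    also have "\<dots> \<in> ?PP" using gram by (intro ideal_sum[OF PP] ideal_mult_left[OF PP]) auto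
    finally show ?thesis .
  qed
  have column: "(\<lambda>i. M $$ (i, j0)) \<in> V"
    using entry(2) unfolding V_def
    by (auto intro!: exI[of _ "\<lambda>j. if j = j0 then 1 else 0"] simp: if_distrib cong: if_cong)
  let ?p = "pderiv (char_poly A)"
  let ?N = "poly_mat ?p A"
  have "\<exists>v\<in>V. (\<exists>i<n. v i \<notin> P) \<and> (\<forall>i<n. poly_apply n A ?p v i \<in> P)"
  proof (rule isotropic_submodule_kernel[OF P(1) A V0])
    show "(\<Sum>i<n. u i * v i) \<in> P" if "u \<in> V" "v \<in> V" for u v
      using iso[OF that] PP_P by blast
  qed (fact V_closed column entry)+
  then obtain v m where v: "v \<in> V" "m < n" "v m \<notin> P"
    and ker: "\<And>i. i < n \<Longrightarrow> poly_apply n A ?p v i \<in> P" by blast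
  \<comment> \<open>Since this vector stays in \<open>V\<close>, its pairing with \<open>v\<close>
    lies in \<open>P^2\<close> and not merely in \<open>P\<close>.\<close>
  have poly_v: "poly_apply n A ?p v \<in> V"
    by (rule poly_apply_closed) (fact V0 V_closed v(1))+
  have N: "?N \<in> carrier_mat n n" using A(1) by (simp add: poly_mat_def)
  have "v m * v m * det ?N \<in> ?PP"
  proof (rule square_times_det_mem[OF N transpose_poly_mat[OF A] v(2) idP PP ideal_prod_mem])
    show "(\<Sum>j<n. ?N $$ (i, j) * v j) \<in> P" if "i < n" for i
      using ker[OF that] by (simp add: poly_mat_apply[OF A(1) that])
    have "(\<Sum>i<n. v i * (\<Sum>j<n. ?N $$ (i, j) * v j)) = (\<Sum>i<n. v i * poly_apply n A ?p v i)"
      by (intro sum.cong) (auto simp: poly_mat_apply[OF A(1)])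
    then show "(\<Sum>i<n. v i * (\<Sum>j<n. ?N $$ (i, j) * v j)) \<in> ?PP"
      using iso[OF v(1) poly_v] by simp
  qed
  moreover have "v m * v m \<notin> P" using v(3) by (simp add: primeideal_mult_iff[OF P(1)])
  ultimately show ?thesis
    unfolding discriminant_def using primeideal_square_primary[OF ded P] by blast
qed

theorem theorem2p1:
  fixes A B :: "'a::idom mat" and Q :: "'a fract mat" and P :: "'a set" and n :: nat
  assumes "dedekind_domain (ring_of_type_algebra :: 'a ring)"
    and "A \<in> carrier_mat n n" and "transpose_mat A = A"
    and "B \<in> carrier_mat n n"
    and "Q \<in> carrier_mat n n" and "Q \<noteq> 0\<^sub>m n n"
    and "map_mat to_fract A * Q = Q * map_mat to_fract B"
    and "transpose_mat Q * Q \<in> integral_mats n"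
    and "primeideal P (ring_of_type_algebra :: 'a ring)" and "P \<noteq> {0}"
    and "P divides\<^bsub>ideals_set ring_of_type_algebra\<^esub> level n Q"
  shows "(P [^]\<^bsub>ideals_set ring_of_type_algebra\<^esub> (2::nat)) divides\<^bsub>ideals_set ring_of_type_algebra\<^esub>
           (PIdl\<^bsub>ring_of_type_algebra\<^esub> (discriminant A))"
proof -
  interpret cring "type_ring :: 'a ring" by (rule cring_from_type_algebra)
  interpret inj_comm_ring_hom "to_fract :: 'a \<Rightarrow> 'a fract" by unfold_locales auto
  note A = assms(2,3) and B = assms(4) and Q = assms(5) and P = assms(9,10)
  note idP = primeideal_ideal[OF P(1)]
  obtain C where C: "ideal C type_ring" "level n Q = P \<cdot>\<^bsub>type_ring\<^esub> C"
    using assms(11) by (auto simp: factor_def ideals_set_simps)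
  obtain r M where r: "r \<in> P" and M: "M \<in> carrier_mat n n" "map_mat to_fract M = to_fract r \<cdot>\<^sub>m Q"
    and entry: "\<exists>i<n. \<exists>j<n. M $$ (i, j) \<notin> P"
    using primitive_multiple[OF assms(1) P Q C] by blast
  \<comment> \<open>The intertwining relation passes to the multiple \<open>r Q\<close> over the
    fraction field and descends by injectivity of \<open>to_fract\<close>.\<close>
  have "map_mat to_fract (A * M) = to_fract r \<cdot>\<^sub>m (map_mat to_fract A * Q)"
    using A(1) Q M(1) by (simp add: mat_hom_mult[OF A(1) M(1)] M(2) mult_smult_distrib[of _ n n _ n])
  also have "\<dots> = map_mat to_fract (M * B)"
    unfolding assms(7) using B Q M(1)
    by (simp add: mat_hom_mult[OF M(1) B] M(2) mult_smult_assoc_mat[of _ n n _ n])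
  finally have AM: "A * M = M * B" by (rule mat_hom_inj)
  obtain G where G: "G \<in> carrier_mat n n" "transpose_mat Q * Q = map_mat to_fract G"
    using assms(8) by (auto simp: integral_mats_def)
  \<comment> \<open>The Gram matrix acquires the factor \<open>r * r\<close>, an element of
    \<open>P^2\<close>, in front of the integral matrix \<open>G\<close>.\<close>
  have "map_mat to_fract (transpose_mat M * M) = map_mat to_fract ((r * r) \<cdot>\<^sub>m G)"
  proof -
    have MT: "transpose_mat M \<in> carrier_mat n n" using M(1) by simp
    have "map_mat to_fract (transpose_mat M * M) =
        transpose_mat (map_mat to_fract M) * map_mat to_fract M"
      by (simp add: mat_hom_mult[OF MT M(1)] map_mat_transpose)
    also have "\<dots> = (to_fract r * to_fract r) \<cdot>\<^sub>m (transpose_mat Q * Q)"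
      unfolding M(2) using Q by (intro eq_matI) (auto simp: scalar_prod_def sum_distrib_left ac_simps)
    also have "\<dots> = map_mat to_fract ((r * r) \<cdot>\<^sub>m G)"
      unfolding G(2) using G(1) by (intro eq_matI) auto
    finally show ?thesis .
  qed
  then have "transpose_mat M * M = (r * r) \<cdot>\<^sub>m G" by (rule mat_hom_inj)
  then have "(transpose_mat M * M) $$ (i, j) \<in> P \<cdot>\<^bsub>type_ring\<^esub> P" if "i < n" "j < n" for i j
    using G(1) that ideal_mult_right[OF ideal_prod_type_ring_ideal[OF idP idP] ideal_prod_mem[OF r r]]
    by simp
  then have "discriminant A \<in> P \<cdot>\<^bsub>type_ring\<^esub> P"
    using discriminant_mem_square[OF assms(1) P A B M(1) AM] entry by blast
  then obtain D where D: "ideal D type_ring"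
    "ideal2 (discriminant A) 0 = (P \<cdot>\<^bsub>type_ring\<^esub> P) \<cdot>\<^bsub>type_ring\<^esub> D"
    using primeideal_square_divides[OF assms(1) P(1)] by blast
  have "PIdl\<^bsub>type_ring\<^esub> (discriminant A) = ideal2 (discriminant A) 0"
    by (auto simp: cgenideal_def ideal2_def)
  moreover have "P [^]\<^bsub>ideals_set type_ring\<^esub> (2::nat) = P \<cdot>\<^bsub>type_ring\<^esub> P"
  proof -
    interpret ISet: comm_monoid "ideals_set (type_ring :: 'a ring)"
      by (rule ideals_set_is_comm_monoid)
    have "P \<in> carrier (ideals_set type_ring)" using idP by (simp add: ideals_set_simps)
    then show ?thesis by (simp add: numeral_2_eq_2 ideals_set_simps(2)[symmetric])
  qed
  ultimately show ?thesis
    using D by (auto simp: factor_def ideals_set_simps)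
qed

end
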